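(* Let $(x,u)\in\Gamma_\tau$, write $\mathfrak{D}=(x,u)$, let $c\ge 0$, and suppose that there exist a system $(A_s,B_s)\in\Sigma_{n,m}$ and a noise signal $w_s\in\Delta_{\tau,c}$ such that $x'(t)=A_sx(t)+B_su(t)+w_s(t)$ for a.e. $t\in[0,\tau]$. Let $(X_{\mathrm d},X,U)$ be the synthesis operator triple associated with $(x,u)$. Then the following statements are equivalent: (i) The data $(x,u)$ are informative for quadratic stabilization under the noise class $\Delta_{\tau,c}$. (ii) There exist matrices $P\in\mathbb{S}^n$, $L\in\mathbb{R}^{m\times n}$ and a scalar $\alpha\ge 0$ such that $P\succ 0$ and $$\begin{bmatrix}\alpha(X_{\mathrm d}X_{\mathrm d}^*-cI_n)-I_n&-P-\alpha X_{\mathrm d}X^*&-L^\top-\alpha X_{\mathrm d}U^*\\-P-\alpha XX_{\mathrm d}^*&\alpha XX^*&\alpha XU^*\\-L-\alpha UX_{\mathrm d}^*&\alpha UX^*&\alpha UU^*\end{bmatrix}\succeq 0.$$ Furthermore, if statement (ii) holds (with such $P$, $L$, $\alpha$), then $K=LP^{-1}$ is such that $A+BK$ is Hurwitz for all $(A,B)\in\Sigma_{\mathfrak{D},c}$.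
   Context: Fix $\tau>0$ and positive integers $n,m$. $\mathbb{S}^n$ is the set of real symmetric $n\times n$ matrices, $I_n$ the identity; $M\succ0$ (resp. $M\succeq0$) means $M$ is symmetric positive definite (resp. nonnegative definite), and $M\preceq N$ means $N-M\succeq 0$. A square matrix is Hurwitz if all its eigenvalues have negative real part. $\mathrm{L}^2([0,\tau];\mathbb{R}^n)$ is the space of (classes of) square-integrable measurable functions $[0,\tau]\to\mathbb{R}^n$; $\mathrm{H}^1([0,\tau];\mathbb{R}^n)$ is the space of absolutely continuous functions $\phi:[0,\tau]\to\mathbb{R}^n$ with $\phi'\in\mathrm{L}^2([0,\tau];\mathbb{R}^n)$; $\mathrm{H}^1_0[0,\tau]$ is the space of scalar functions $\phi\in \mathrm{H}^1([0,\tau];\mathbb{R})$ with $\phi(0)=\phi(\tau)=0$, a Hilbert space with inner product $\langle\phi,\psi\rangle_{\mathrm{H}^1_0}=\int_0^\tau\phi'(t)\psi'(t)\,dt$. $\Gamma_\tau=\{(x,u): x\in\mathrm{H}^1([0,\tau];\mathbb{R}^n),\ u\in\mathrm{L}^2([0,\tau];\mathbb{R}^m)\}$ and $\Sigma_{n,m}=\{(A,B):A\in\mathbb{R}^{n\times n},\ B\in\mathbb{R}^{n\times m}\}$. For $f\in\mathrm{L}^2([0,\tau];\mathbb{R}^k)$, the synthesis operator and the differentiated synthesis operator associated with $f$ are the bounded linear operators $\mathrm{H}^1_0[0,\tau]\to\mathbb{R}^k$ given by $\phi\mapsto\int_0^\tau\phi(t)f(t)\,dt$ and $\phi\mapsto-\int_0^\tau\phi'(t)f(t)\,dt$,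 respectively. For $(x,u)\in\Gamma_\tau$, the synthesis operator triple $(X_{\mathrm d},X,U)$ associated with $(x,u)$ consists of the differentiated synthesis operator $X_{\mathrm d}$ associated with $x$, the synthesis operator $X$ associated with $x$, and the synthesis operator $U$ associated with $u$. $T^*$ denotes the Hilbert space adjoint (with respect to $\langle\cdot,\cdot\rangle_{\mathrm{H}^1_0}$ and the Euclidean inner product); products such as $X_{\mathrm d}X^*$, $XU^*$ are linear maps between Euclidean spaces and are identified with matrices. For $c\ge0$, the noise class is $\Delta_{\tau,c}=\{w\in\mathrm{L}^2([0,\tau];\mathbb{R}^n): WW^*\preceq cI_n\}$, where $W$ is the synthesis operator associated with $w$. For $\mathfrak{D}=(x,u)\in\Gamma_\tau$, $$\Sigma_{\mathfrak{D},c}=\{(A,B)\in\Sigma_{n,m}:\ \text{there exists } w\in\Delta_{\tau,c}\text{ such that } x'=Ax+Bu+w\text{ a.e. on }[0,\tau]\}.$$ The data $\mathfrak{D}=(x,u)$ are called informative for quadratic stabilization under the noise class $\Delta_{\tau,c}$ if there exist $P\in\mathbb{S}^n$ and $K\in\mathbb{R}^{m\times n}$ such that $P\succ0$ and $-(A+BK)P-P(A+BK)^\top\succ0$ for all $(A,B)\in\Sigma_{\mathfrak{D},c}$. *)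

theory Defs
  imports "HOL-Analysis.Analysis"
begin

section \<open>Matrices\<close>

definition pos_def :: "real^'k^'k \<Rightarrow> bool" where
  "pos_def M \<longleftrightarrow> transpose M = M \<and> (\<forall>v. v \<noteq> 0 \<longrightarrow> v \<bullet> (M *v v) > 0)"

definition pos_semidef :: "real^'k^'k \<Rightarrow> bool" where
  "pos_semidef M \<longleftrightarrow> transpose M = M \<and> (\<forall>v. v \<bullet> (M *v v) \<ge> 0)"

definition loewner_le :: "real^'k^'k \<Rightarrow> real^'k^'k \<Rightarrow> bool" where
  "loewner_le M N \<longleftrightarrow> pos_semidef (N - M)"

definition eigenvalue :: "complex^'k^'k \<Rightarrow> complex \<Rightarrow> bool" where
  "eigenvalue M z \<longleftrightarrow> (\<exists>v. v \<noteq> 0 \<and> M *v v = z *s v)"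

definition hurwitz :: "real^'k^'k \<Rightarrow> bool" where
  "hurwitz M \<longleftrightarrow> (\<forall>z. eigenvalue (map_matrix complex_of_real M) z \<longrightarrow> Re z < 0)"

text \<open>Rows and columns of a \<open>3 \<times> 3\<close> block matrix are indexed by the sum type \<open>'a + 'b + 'c\<close>,
  which associates to the right.\<close>

definition block3 ::
  "real^'a^'a \<Rightarrow> real^'b^'a \<Rightarrow> real^'c^'a \<Rightarrow>
   real^'a^'b \<Rightarrow> real^'b^'b \<Rightarrow> real^'c^'b \<Rightarrow>
   real^'a^'c \<Rightarrow> real^'b^'c \<Rightarrow> real^'c^'c \<Rightarrow>
   real^('a + 'b + 'c)^('a + 'b + 'c)" where
  "block3 M11 M12 M13 M21 M22 M23 M31 M32 M33 = (\<chi> i j.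
     case i of
       Inl i1 \<Rightarrow> (case j of Inl j1 \<Rightarrow> M11 $ i1 $ j1
                  | Inr (Inl j2) \<Rightarrow> M12 $ i1 $ j2
                  | Inr (Inr j3) \<Rightarrow> M13 $ i1 $ j3)
     | Inr (Inl i2) \<Rightarrow> (case j of Inl j1 \<Rightarrow> M21 $ i2 $ j1
                  | Inr (Inl j2) \<Rightarrow> M22 $ i2 $ j2
                  | Inr (Inr j3) \<Rightarrow> M23 $ i2 $ j3)
     | Inr (Inr i3) \<Rightarrow> (case j of Inl j1 \<Rightarrow> M31 $ i3 $ j1
                  | Inr (Inl j2) \<Rightarrow> M32 $ i3 $ j2
                  | Inr (Inr j3) \<Rightarrow> M33 $ i3 $ j3))"


section \<open>Function spaces on the interval from 0 to \<open>\<tau>\<close>\<close>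

text \<open>A function on the interval is represented by a function on all of \<open>\<real>\<close>; its values outside
  the interval are irrelevant to every notion below. Elements of \<open>L\<^sup>2\<close> are
  represented by functions rather than by equivalence classes.\<close>

definition L2 :: "real \<Rightarrow> (real \<Rightarrow> 'a::euclidean_space) set" where
  "L2 \<tau> = {f. f \<in> borel_measurable (lebesgue_on {0..\<tau>}) \<and>
              integrable (lebesgue_on {0..\<tau>}) (\<lambda>t. (norm (f t))\<^sup>2)}"

text \<open>A finite family of non-overlapping subintervals is given by the finite set \<open>D\<close> of its
  pairs of endpoints.\<close>

definition abs_continuous_on_ivl :: "real \<Rightarrow> (real \<Rightarrow> 'a::euclidean_space) \<Rightarrow> bool" where
  "abs_continuous_on_ivl \<tau> f \<longleftrightarrow>
     (\<forall>\<epsilon>>0. \<exists>\<delta>>0. \<forall>D.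
        finite D \<and> (\<forall>(a, b)\<in>D. 0 \<le> a \<and> a \<le> b \<and> b \<le> \<tau>) \<and>
        disjoint_family_on (\<lambda>(a, b). {a<..<b}) D \<and> (\<Sum>(a, b)\<in>D. b - a) < \<delta>
        \<longrightarrow> (\<Sum>(a, b)\<in>D. norm (f b - f a)) < \<epsilon>)"

definition ivl_deriv :: "real \<Rightarrow> (real \<Rightarrow> 'a::euclidean_space) \<Rightarrow> real \<Rightarrow> 'a" where
  "ivl_deriv \<tau> f t = vector_derivative f (at t within {0..\<tau>})"

text \<open>By Lebesgue's theorem an absolutely continuous function is differentiable almost everywhere;
  this is listed explicitly because \<^const>\<open>vector_derivative\<close> is an arbitrary value at points of
  non-differentiability.\<close>

definition H1 :: "real \<Rightarrow> (real \<Rightarrow> 'a::euclidean_space) set" where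
  "H1 \<tau> = {f. abs_continuous_on_ivl \<tau> f \<and>
              (AE t in lebesgue_on {0..\<tau>}. f differentiable (at t within {0..\<tau>})) \<and>
              ivl_deriv \<tau> f \<in> L2 \<tau>}"

definition H10 :: "real \<Rightarrow> (real \<Rightarrow> real) set" where
  "H10 \<tau> = {\<phi> \<in> H1 \<tau>. \<phi> 0 = 0 \<and> \<phi> \<tau> = 0}"

definition H10_inner :: "real \<Rightarrow> (real \<Rightarrow> real) \<Rightarrow> (real \<Rightarrow> real) \<Rightarrow> real" where
  "H10_inner \<tau> \<phi> \<psi> = (LINT t|lebesgue_on {0..\<tau>}. ivl_deriv \<tau> \<phi> t * ivl_deriv \<tau> \<psi> t)"


section \<open>Synthesis operators\<close>

definition synthesis :: "real \<Rightarrow> (real \<Rightarrow> real^'k) \<Rightarrow> (real \<Rightarrow> real) \<Rightarrow> real^'k" where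
  "synthesis \<tau> f \<phi> = (LINT t|lebesgue_on {0..\<tau>}. \<phi> t *\<^sub>R f t)"

definition diff_synthesis :: "real \<Rightarrow> (real \<Rightarrow> real^'k) \<Rightarrow> (real \<Rightarrow> real) \<Rightarrow> real^'k" where
  "diff_synthesis \<tau> f \<phi> = - (LINT t|lebesgue_on {0..\<tau>}. ivl_deriv \<tau> \<phi> t *\<^sub>R f t)"

text \<open>The Hilbert space adjoint of \<open>T : H\<^sup>1\<^sub>0 \<rightarrow> \<real>\<^sup>k\<close>. The element \<open>T\<^sup>* v\<close> is
  unique as a function on the interval; the choice operator only selects its values outside.\<close>

definition H10_adjoint ::
  "real \<Rightarrow> ((real \<Rightarrow> real) \<Rightarrow> real^'k) \<Rightarrow> real^'k \<Rightarrow> (real \<Rightarrow> real)" where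
  "H10_adjoint \<tau> T v =
     (SOME \<psi>. \<psi> \<in> H10 \<tau> \<and> (\<forall>\<phi>\<in>H10 \<tau>. T \<phi> \<bullet> v = H10_inner \<tau> \<phi> \<psi>))"

text \<open>The matrix of \<open>S T\<^sup>*\<close>.\<close>

definition mult_adj ::
  "real \<Rightarrow> ((real \<Rightarrow> real) \<Rightarrow> real^'j) \<Rightarrow> ((real \<Rightarrow> real) \<Rightarrow> real^'k) \<Rightarrow> real^'k^'j" where
  "mult_adj \<tau> S T = matrix (\<lambda>v. S (H10_adjoint \<tau> T v))"


section \<open>Data, noise and informativity\<close>

definition data_space :: "real \<Rightarrow> ((real \<Rightarrow> real^'n) \<times> (real \<Rightarrow> real^'m)) set" where
  "data_space \<tau> = H1 \<tau> \<times> L2 \<tau>"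

definition noise_class :: "real \<Rightarrow> real \<Rightarrow> (real \<Rightarrow> real^'n) set" where
  "noise_class \<tau> c =
     {w \<in> L2 \<tau>. loewner_le (mult_adj \<tau> (synthesis \<tau> w) (synthesis \<tau> w)) (c *\<^sub>R mat 1)}"

definition satisfies_system ::
  "real \<Rightarrow> real^'n^'n \<Rightarrow> real^'m^'n \<Rightarrow> (real \<Rightarrow> real^'n) \<Rightarrow> (real \<Rightarrow> real^'m) \<Rightarrow> (real \<Rightarrow> real^'n) \<Rightarrow> bool"
  where
  "satisfies_system \<tau> A B x u w \<longleftrightarrow>
     (AE t in lebesgue_on {0..\<tau>}. ivl_deriv \<tau> x t = A *v x t + B *v u t + w t)"

definition consistent_systems ::
  "real \<Rightarrow> real \<Rightarrow> (real \<Rightarrow> real^'n) \<times> (real \<Rightarrow> real^'m) \<Rightarrow> ((real^'n^'n) \<times> (real^'m^'n)) set" where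
  "consistent_systems \<tau> c = (\<lambda>(x, u).
     {(A, B). \<exists>w \<in> noise_class \<tau> c. satisfies_system \<tau> A B x u w})"

definition informative_quad_stab ::
  "real \<Rightarrow> real \<Rightarrow> (real \<Rightarrow> real^'n) \<times> (real \<Rightarrow> real^'m) \<Rightarrow> bool" where
  "informative_quad_stab \<tau> c \<DD> \<longleftrightarrow>
     (\<exists>(P::real^'n^'n) (K::real^'n^'m). pos_def P \<and>
        (\<forall>(A, B) \<in> consistent_systems \<tau> c \<DD>.
           pos_def (- ((A + B ** K) ** P) - P ** transpose (A + B ** K))))"

definition stab_lmi_matrix ::
  "real \<Rightarrow> real \<Rightarrow> ((real \<Rightarrow> real) \<Rightarrow> real^'n) \<Rightarrow> ((real \<Rightarrow> real) \<Rightarrow> real^'n) \<Rightarrow>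
   ((real \<Rightarrow> real) \<Rightarrow> real^'m) \<Rightarrow> real^'n^'n \<Rightarrow> real^'n^'m \<Rightarrow> real \<Rightarrow>
   real^('n + 'n + 'm)^('n + 'n + 'm)" where
  "stab_lmi_matrix \<tau> c Xd X U P L \<alpha> = block3
     (\<alpha> *\<^sub>R (mult_adj \<tau> Xd Xd - c *\<^sub>R mat 1) - mat 1)
       (- P - \<alpha> *\<^sub>R mult_adj \<tau> Xd X)
         (- transpose L - \<alpha> *\<^sub>R mult_adj \<tau> Xd U)
     (- P - \<alpha> *\<^sub>R mult_adj \<tau> X Xd)
       (\<alpha> *\<^sub>R mult_adj \<tau> X X)
         (\<alpha> *\<^sub>R mult_adj \<tau> X U)
     (- L - \<alpha> *\<^sub>R mult_adj \<tau> U Xd)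
       (\<alpha> *\<^sub>R mult_adj \<tau> U X)
         (\<alpha> *\<^sub>R mult_adj \<tau> U U)"

end

theory Submission
  imports Defs
begin

text \<open>
An operator \<open>T\<close> on \<open>H10\<close> of the form \<open>\<phi> \<mapsto> - \<integral> \<phi>' g\<close> with continuous \<open>g\<close> sees \<open>g\<close> only up to constants. Writing
\<open>centred \<tau> g\<close> for \<open>g\<close> minus its mean, the adjoint \<open>T\<^sup>* v\<close> is the function vanishing at both ends with derivative
\<open>- (centred \<tau> g \<bullet> v)\<close>. Hence, for two such operators, \<open>S T\<^sup>*\<close> is the Gram matrix of the centred
functions (\<open>inner_mult_adj\<close>). All operators of the theorem have this form: \<open>X\<^sub>d\<close> is given by \<open>x\<close> itself, the
synthesis operators \<open>X\<close> and \<open>U\<close> are given by the primitives of \<open>x\<close> and \<open>u\<close> through an integration by parts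
(\<open>integral_by_parts\<close>), and the operator of the noise \<open>x' - A x - B u\<close> is \<open>X\<^sub>d - A X - B U\<close>
(\<open>represents_noise\<close>). The analysis behind this is the fundamental theorem of calculus for absolutely
continuous functions (\<open>abs_continuous_has_integral_deriv\<close>).

The problem becomes finite-dimensional. Let \<open>q \<xi> (y, z)\<close> be \<open>c (\<xi> \<bullet> \<xi>)\<close> minus the squared \<open>L\<^sup>2\<close> norm of
\<open>centred x \<bullet> \<xi> - centred \<X> \<bullet> y - centred \<U> \<bullet> z\<close>, where \<open>\<X>\<close> and \<open>\<U>\<close> are the primitives. A system \<open>(A, B)\<close> is
consistent with the data if and only if \<open>q \<xi> (A\<^sup>T \<xi>, B\<^sup>T \<xi>) \<ge> 0\<close> for all \<open>\<xi>\<close> (\<open>consistent_iff\<close>), and the block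
matrix inequality says \<open>- 2 (P \<xi> \<bullet> y + L \<xi> \<bullet> z) - \<xi> \<bullet> \<xi> \<ge> \<alpha> q \<xi> (y, z)\<close> for all vectors
(\<open>pos_semidef_lmi_iff\<close>). With \<open>y = A\<^sup>T \<xi>\<close> and \<open>z = B\<^sup>T \<xi>\<close> the left-hand side is the Lyapunov expression
\<open>- 2 \<xi> \<bullet> (A + B K) P \<xi>\<close> for \<open>K = L P\<inverse>\<close> minus \<open>\<xi> \<bullet> \<xi>\<close>, so the block inequality implies the Lyapunov
inequality for every consistent system, and thereby stability (\<open>lyapunov_hurwitz\<close>).

The converse is a matrix version of the S-lemma (\<open>matrix_S_lemma\<close>). Every pair \<open>(\<xi>, (y, z))\<close> with \<open>\<xi> \<noteq> 0\<close> and
\<open>q \<xi> (y, z) \<ge> 0\<close> lies on the graph of some consistent system (\<open>interpolation\<close>), so quadratic stabilization is an implication between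
the signs of two quadratic forms, and the classical S-lemma yields the multiplier \<open>\<alpha>\<close>. Two degeneracies
need care: the set of consistent systems may be unbounded, and \<open>q\<close> may take no positive value. The
first is met by splitting off the null directions of the data, the second by a compactness argument that leaves
room to relax the noise bound slightly.
\<close>

section \<open>The fundamental theorem of calculus for absolutely continuous functions\<close>

text \<open>In the Riemann sum below, the intervals whose tags lie in the exceptional null set can be put inside an
open set \<open>T\<close> of measure less than \<open>\<delta>\<close>. Absolute continuity then makes the total increment of \<open>f\<close> over them
small. Its hypothesis is about a set of endpoint pairs, so the work here is to pass from tagged intervals to
endpoint pairs without merging two of them.\<close>

lemma abs_continuous_sum_small:
  fixes f :: "real \<Rightarrow> 'a::euclidean_space"
  assumes ac: "\<And>E. finite E \<Longrightarrow> (\<forall>(u, v)\<in>E. 0 \<le> u \<and> u \<le> v \<and> v \<le> \<tau>) \<Longrightarrow>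
        disjoint_family_on (\<lambda>(u, v). {u<..<v}) E \<Longrightarrow> (\<Sum>(u, v)\<in>E. v - u) < \<delta> \<Longrightarrow>
        (\<Sum>(u, v)\<in>E. norm (f v - f u)) < \<epsilon>"
    and D: "D tagged_partial_division_of {0..\<tau>}"
    and T: "open T" "T \<in> lmeasurable" "measure lebesgue T < \<delta>"
    and DT: "\<And>t K. (t, K) \<in> D \<Longrightarrow> K \<subseteq> T"
  shows "(\<Sum>(t, K)\<in>D. norm (f (Sup K) - f (Inf K))) < \<epsilon>"
proof -
  note D' = tagged_partial_division_ofD[OF D]
  define h where "h = (\<lambda>(t::real, K::real set). (Inf K, Sup K))"
  have K: "K = {Inf K..Sup K} \<and> Inf K \<le> Sup K \<and> interior K = {Inf K<..<Sup K} \<and> 0 \<le> Inf K \<and> Sup K \<le> \<tau>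
      \<and> (Inf K = Sup K \<longrightarrow> t = Inf K)"
    if tK: "(t, K) \<in> D" for t K
  proof -
    obtain a b where ab: "K = {a..b}" using D'(4)[OF tK] by auto
    have "t \<in> K" "K \<subseteq> {0..\<tau>}" using D' tK by auto
    then have "a \<le> b" "0 \<le> a" "b \<le> \<tau>" by (auto simp: ab)
    with \<open>t \<in> K\<close> show ?thesis by (auto simp: ab)
  qed
  have disj: "interior K1 \<inter> interior K2 = {}"
    if "(t1, K1) \<in> D" "(t2, K2) \<in> D" "(t1, K1) \<noteq> (t2, K2)" for t1 K1 t2 K2
    using D'(5) that by blast
  have inj: "inj_on h D"
  proof (rule inj_onI, clarify)
    fix t1 K1 t2 K2
    assume 1: "(t1, K1) \<in> D" and 2: "(t2, K2) \<in> D" and "h (t1, K1) = h (t2, K2)"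
    then have eq: "Inf K1 = Inf K2" "Sup K1 = Sup K2" by (auto simp: h_def)
    then have KK: "K1 = K2" using K[OF 1] K[OF 2] by metis
    moreover have "t1 = t2"
    \<comment> \<open>Two entries with the same interval can only differ if that interval is a point, and then the tag is that point.\<close>
    proof (rule ccontr)
      assume "t1 \<noteq> t2"
      then have "interior K1 = {}" using disj[OF 1 2] KK by auto
      then have "Inf K1 = Sup K1" using K[OF 1] by (metis greaterThanLessThan_empty_iff order_antisym)
      then show False using K[OF 1] K[OF 2] KK \<open>t1 \<noteq> t2\<close> by auto
    qed
    ultimately show "t1 = t2 \<and> K1 = K2" by simp
  qed
  have "(\<Sum>(u, v)\<in>h ` D. norm (f v - f u)) < \<epsilon>"
  proof (rule ac)
    show "finite (h ` D)" using D'(1) by auto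
    show "\<forall>(u, v)\<in>h ` D. 0 \<le> u \<and> u \<le> v \<and> v \<le> \<tau>"
      using K by (fastforce simp: h_def)
    show "disjoint_family_on (\<lambda>(u, v). {u<..<v}) (h ` D)"
      unfolding disjoint_family_on_def
    proof (intro ballI impI)
      fix p q assume "p \<in> h ` D" "q \<in> h ` D" "p \<noteq> q"
      then obtain t1 K1 t2 K2 where 1: "(t1, K1) \<in> D" and 2: "(t2, K2) \<in> D"
        and pq: "p = (Inf K1, Sup K1)" "q = (Inf K2, Sup K2)"
        by (auto simp: h_def)
      have "interior K1 \<inter> interior K2 = {}"
        using \<open>p \<noteq> q\<close> pq by (intro disj[OF 1 2]) auto
      then show "(case p of (u, v) \<Rightarrow> {u<..<v}) \<inter> (case q of (u, v) \<Rightarrow> {u<..<v}) = {}"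
        using K[OF 1] K[OF 2] by (simp add: pq)
    qed
    have "(\<Sum>(u, v)\<in>h ` D. v - u) = (\<Sum>(t, K)\<in>D. Sup K - Inf K)"
      by (subst sum.reindex[OF inj]) (auto simp: h_def split_def)
    also have "\<dots> = (\<Sum>p\<in>D. measure lebesgue (interior (snd p)))"
    proof (rule sum.cong[OF refl])
      fix p assume "p \<in> D"
      then have "(fst p, snd p) \<in> D" by simp
      from K[OF this] have "Sup (snd p) - Inf (snd p) = measure lebesgue (interior (snd p))"
        by (metis measure_completion measure_lborel_Ioo borel_open open_greaterThanLessThan sets_lborel)
      then show "(case p of (t, K) \<Rightarrow> Sup K - Inf K) = measure lebesgue (interior (snd p))"
        by (simp add: split_def)
    qed
    also have "\<dots> = measure lebesgue (\<Union>p\<in>D. interior (snd p))"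
    proof (rule measure_finite_Union[symmetric])
      show "disjoint_family_on (\<lambda>p. interior (snd p)) D"
        unfolding disjoint_family_on_def
      proof (intro ballI impI)
        fix p q assume "p \<in> D" "q \<in> D" "p \<noteq> q"
        then show "interior (snd p) \<inter> interior (snd q) = {}"
          using disj[of "fst p" "snd p" "fst q" "snd q"] by (simp add: prod_eq_iff)
      qed
      show "emeasure lebesgue (interior (snd p)) \<noteq> \<infinity>" if "p \<in> D" for p
      proof -
        from that have "(fst p, snd p) \<in> D" by simp
        from K[OF this] have "interior (snd p) = {Inf (snd p)<..<Sup (snd p)}" "Inf (snd p) \<le> Sup (snd p)"
          by blast+
        then show ?thesis by simp
      qed
    qed (use D'(1) in auto)
    also have "\<dots> \<le> measure lebesgue T"
    proof (rule measure_mono_fmeasurable)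
      show "(\<Union>p\<in>D. interior (snd p)) \<subseteq> T" using DT interior_subset by fastforce
    qed (use T(2) D'(1) in auto)
    also have "\<dots> < \<delta>" by fact
    finally show "(\<Sum>(u, v)\<in>h ` D. v - u) < \<delta>" .
  qed
  also have "(\<Sum>(u, v)\<in>h ` D. norm (f v - f u)) = (\<Sum>(t, K)\<in>D. norm (f (Sup K) - f (Inf K)))"
    by (subst sum.reindex[OF inj]) (auto simp: h_def split_def)
  finally show ?thesis .
qed

lemma ivl_deriv_works:
  assumes "f differentiable (at t within {0..\<tau>})"
  shows "(f has_vector_derivative ivl_deriv \<tau> f t) (at t within {0..\<tau>})"
  using assms by (simp add: ivl_deriv_def vector_derivative_works)

text \<open>The gauge for the Riemann sums of the derivative is chosen in two ways. At a point of differentiability it is the radius on which the difference quotient is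
accurate to \<open>e'\<close>; at a point of the exceptional null set it is an open superset of that set of tiny measure.
The first kind of intervals contributes at most \<open>e' (b - a)\<close> to the error of the Riemann sum, the second kind
is controlled by absolute continuity.\<close>

lemma abs_continuous_has_integral_deriv:
  fixes f :: "real \<Rightarrow> 'a::euclidean_space"
  assumes ac: "abs_continuous_on_ivl \<tau> f"
    and diff: "AE t in lebesgue_on {0..\<tau>}. f differentiable (at t within {0..\<tau>})"
    and ab: "0 \<le> a" "a \<le> b" "b \<le> \<tau>"
  shows "(ivl_deriv \<tau> f has_integral f b - f a) {a..b}"
proof -
  define N where "N = {t \<in> {0..\<tau>}. \<not> f differentiable (at t within {0..\<tau>})}"
  have "AE t in lebesgue. t \<notin> N"
    using diff by (auto simp: AE_restrict_space_iff N_def elim!: eventually_mono)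
  then have N0: "N \<in> null_sets lebesgue"
    by (auto simp: null_sets_completion_iff2 AE_completion_iff eventually_ae_filter) blast
  define g where "g t = (if t \<in> N then 0 else ivl_deriv \<tau> f t)" for t
  have g: "(f has_vector_derivative g t) (at t within {0..\<tau>})" if "t \<in> {0..\<tau>} - N" for t
    using ivl_deriv_works that by (auto simp: N_def g_def)
  have "(g has_integral f b - f a) {a..b}"
    unfolding has_integral_real
  proof (intro allI impI)
    fix e :: real assume "e > 0"
    define e' where "e' = e / 2 / (b - a + 1)"
    have e': "e' > 0" "e' * (b - a) < e / 2"
      using \<open>e > 0\<close> ab by (auto simp: e'_def divide_simps)
    obtain \<delta> where "\<delta> > 0" and \<delta>': "\<forall>E. finite E \<and> (\<forall>(u, v)\<in>E. 0 \<le> u \<and> u \<le> v \<and> v \<le> \<tau>) \<and>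
        disjoint_family_on (\<lambda>(u, v). {u<..<v}) E \<and> (\<Sum>(u, v)\<in>E. v - u) < \<delta> \<longrightarrow>
        (\<Sum>(u, v)\<in>E. norm (f v - f u)) < e / 2"
      using ac[unfolded abs_continuous_on_ivl_def, rule_format, of "e / 2"] \<open>e > 0\<close> by auto
    have \<delta>: "(\<Sum>(u, v)\<in>E. norm (f v - f u)) < e / 2"
      if "finite E" "\<forall>(u, v)\<in>E. 0 \<le> u \<and> u \<le> v \<and> v \<le> \<tau>"
        "disjoint_family_on (\<lambda>(u, v). {u<..<v}) E" "(\<Sum>(u, v)\<in>E. v - u) < \<delta>" for E
      using \<delta>' that by blast
    obtain T where T: "open T" "N \<subseteq> T" "T - N \<in> lmeasurable" "emeasure lebesgue (T - N) < ennreal \<delta>"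
      using sets_lebesgue_outer_open[of N \<delta>] N0 \<open>\<delta> > 0\<close> by blast
    have eT: "emeasure lebesgue (T - N) = emeasure lebesgue T"
      using N0 by (intro emeasure_Diff_null_set) (auto simp: T)
    have Tm: "T \<in> lmeasurable"
      using T eT by (intro fmeasurableI) (auto simp: fmeasurable_def)
    have "measure lebesgue T < \<delta>"
      using T(4) eT \<open>\<delta> > 0\<close> Tm by (simp add: emeasure_eq_measure2 ennreal_less_iff)
    have "\<exists>d>0. t \<in> {0..\<tau>} - N \<longrightarrow> (\<forall>y\<in>{0..\<tau>}. norm (y - t) < d \<longrightarrow>
        norm (f y - f t - (y - t) *\<^sub>R g t) \<le> e' * norm (y - t))" for t
    proof (cases "t \<in> {0..\<tau>} - N")
      case True
      then show ?thesis using g[OF True] e'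
        unfolding has_vector_derivative_def has_derivative_within_alt by blast
    qed (use zero_less_one in blast)
    then obtain d where d0: "\<And>t. d t > 0" and d: "\<And>t y. \<lbrakk>t \<in> {0..\<tau>} - N; y \<in> {0..\<tau>}; norm (y - t) < d t\<rbrakk>
        \<Longrightarrow> norm (f y - f t - (y - t) *\<^sub>R g t) \<le> e' * norm (y - t)"
      by metis
    define \<gamma> where "\<gamma> t = (if t \<in> N then T else ball t (d t))" for t
    show "\<exists>\<gamma>. gauge \<gamma> \<and> (\<forall>D. D tagged_division_of {a..b} \<and> \<gamma> fine D \<longrightarrow>
        norm ((\<Sum>(t, K)\<in>D. measure lborel K *\<^sub>R g t) - (f b - f a)) < e)"
    proof (intro exI conjI allI impI)
      show "gauge \<gamma>" using T d0 by (auto simp: gauge_def \<gamma>_def)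
      fix D assume "D tagged_division_of {a..b} \<and> \<gamma> fine D"
      then have D: "D tagged_division_of {a..b}" and fine: "\<gamma> fine D" by auto
      note D' = tagged_division_ofD[OF D]
      have K: "\<exists>u v. K = {u..v} \<and> u \<le> v \<and> Inf K = u \<and> Sup K = v \<and> a \<le> u \<and> v \<le> b \<and> t \<in> K"
        if tK: "(t, K) \<in> D" for t K
      proof -
        obtain u v where uv: "K = {u..v}" using D'(4)[OF tK] by auto
        moreover have "t \<in> K" "K \<subseteq> {a..b}" using D' tK by auto
        ultimately show ?thesis by auto
      qed
      \<comment> \<open>Tags at points of differentiability, and tags in the exceptional null set.\<close>
      define D1 where "D1 = {p \<in> D. fst p \<notin> N}"
      define D2 where "D2 = {p \<in> D. fst p \<in> N}"
      have fin: "finite D1" "finite D2" using D'(1) by (auto simp: D1_def D2_def)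
      define r where "r = (\<lambda>(t, K). measure lborel K *\<^sub>R g t - (f (Sup K) - f (Inf K)))"
      have "(\<Sum>(t, K)\<in>D. measure lborel K *\<^sub>R g t) - (f b - f a) = sum r D"
        using additive_tagged_division_1[OF \<open>a \<le> b\<close> D, of f]
        by (simp add: r_def split_def sum_subtractf)
      also have "sum r D = sum r D1 + sum r D2"
        using D'(1) by (subst sum.union_disjoint[symmetric]) (auto simp: D1_def D2_def intro!: sum.cong)
      finally have "norm ((\<Sum>(t, K)\<in>D. measure lborel K *\<^sub>R g t) - (f b - f a)) \<le> norm (sum r D1) + norm (sum r D2)"
        by (simp add: norm_triangle_ineq)
      also have "norm (sum r D1) \<le> (\<Sum>(t, K)\<in>D1. e' * measure lborel K)"
      proof (rule sum_norm_le, clarify)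
        fix t K assume "(t, K) \<in> D1"
        then have tK: "(t, K) \<in> D" "t \<notin> N" by (auto simp: D1_def)
        obtain u v where uv: "K = {u..v}" "u \<le> v" "Inf K = u" "Sup K = v" "a \<le> u" "v \<le> b" "t \<in> K"
          using K[OF tK(1)] by blast
        have t: "t \<in> {0..\<tau>} - N" using tK uv ab by auto
        have "K \<subseteq> ball t (d t)" using fineD[OF fine tK(1)] tK(2) by (simp add: \<gamma>_def)
        moreover have "u \<in> K" "v \<in> K" using uv by auto
        ultimately have near: "norm (u - t) < d t" "norm (v - t) < d t"
          by (auto simp: dist_norm norm_minus_commute subset_iff)
        \<comment> \<open>The increment over an interval is split at its tag, where the linear approximation is centred.\<close>
        have "r (t, K) = (f u - f t - (u - t) *\<^sub>R g t) - (f v - f t - (v - t) *\<^sub>R g t)"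
          using uv by (simp add: r_def algebra_simps)
        also have "norm \<dots> \<le> norm (f u - f t - (u - t) *\<^sub>R g t) + norm (f v - f t - (v - t) *\<^sub>R g t)"
          by (rule norm_triangle_ineq4)
        also have "\<dots> \<le> e' * norm (u - t) + e' * norm (v - t)"
          using d[OF t _ near(1)] d[OF t _ near(2)] uv ab by (intro add_mono) auto
        also have "\<dots> = e' * measure lborel K"
          using uv by (simp add: algebra_simps)
        finally show "norm (r (t, K)) \<le> e' * measure lborel K" .
      qed
      also have "\<dots> \<le> (\<Sum>(t, K)\<in>D. e' * measure lborel K)"
        using D'(1) e' by (intro sum_mono2) (auto simp: D1_def)
      also have "\<dots> = e' * (b - a)"
        using additive_content_tagged_division[of D a b] D ab
        by (simp add: split_def sum_distrib_left[symmetric])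
      also have "e' * (b - a) < e / 2" by (rule e')
      also have "norm (sum r D2) \<le> (\<Sum>(t, K)\<in>D2. norm (f (Sup K) - f (Inf K)))"
        by (rule sum_norm_le) (auto simp: r_def D2_def g_def norm_minus_commute)
      also have "\<dots> < e / 2"
      proof (rule abs_continuous_sum_small[where T = T and \<tau> = \<tau>])
        have "D2 tagged_partial_division_of {a..b}"
          using D by (auto simp: D2_def tagged_division_of_def intro: tagged_partial_division_subset)
        moreover have "{a..b} \<subseteq> {0..\<tau>}" using ab by auto
        ultimately show "D2 tagged_partial_division_of {0..\<tau>}"
          unfolding tagged_partial_division_of_def by (meson order_trans)
        show "K \<subseteq> T" if "(t, K) \<in> D2" for t K
          using fineD[OF fine, of t K] that by (simp add: \<gamma>_def D2_def)
        show "(\<Sum>(u, v)\<in>E. norm (f v - f u)) < e / 2"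
          if "finite E" "\<forall>(u, v)\<in>E. 0 \<le> u \<and> u \<le> v \<and> v \<le> \<tau>"
            "disjoint_family_on (\<lambda>(u, v). {u<..<v}) E" "(\<Sum>(u, v)\<in>E. v - u) < \<delta>" for E
          using that by (rule \<delta>)
      qed (fact T(1) Tm \<open>measure lebesgue T < \<delta>\<close>)+
      finally show "norm ((\<Sum>(t, K)\<in>D. measure lborel K *\<^sub>R g t) - (f b - f a)) < e" by simp
    qed
  qed
  then show ?thesis
    by (rule has_integral_spike[where S = N, rotated 2]) (use N0 in \<open>auto simp: g_def negligible_iff_null_sets\<close>)
qed

section \<open>Square-integrable functions and integration by parts\<close>

abbreviation ivl_measure :: "real \<Rightarrow> real measure" where
  "ivl_measure \<tau> \<equiv> lebesgue_on {0..\<tau>}"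

lemma finite_measure_ivl: "finite_measure (ivl_measure \<tau>)"
  by (rule finite_measure_lebesgue_on) auto

lemma L2_integrable:
  assumes "f \<in> L2 \<tau>"
  shows "integrable (ivl_measure \<tau>) f"
proof (rule Bochner_Integration.integrable_bound)
  show "integrable (ivl_measure \<tau>) (\<lambda>t. 1 + (norm (f t))\<^sup>2)"
    using assms by (auto simp: L2_def)
  have "norm (f t) \<le> norm (1 + (norm (f t))\<^sup>2)" for t
  proof -
    have "0 \<le> (norm (f t) - 1)\<^sup>2" by simp
    then have "2 * norm (f t) \<le> 1 + (norm (f t))\<^sup>2" by (simp add: power2_eq_square algebra_simps)
    then have "norm (f t) \<le> 1 + (norm (f t))\<^sup>2" using norm_ge_zero[of "f t"] by linarith
    then show ?thesis by simp
  qed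
  then show "AE t in ivl_measure \<tau>. norm (f t) \<le> norm (1 + (norm (f t))\<^sup>2)" by simp
qed (use assms in \<open>auto simp: L2_def\<close>)

lemma L2_dominated:
  assumes "f \<in> L2 \<tau>" "g \<in> L2 \<tau>" "k \<in> borel_measurable (ivl_measure \<tau>)"
    and "\<And>t. norm (k t) \<le> C * (norm (f t) + norm (g t))" and "C \<ge> 0"
  shows "k \<in> L2 \<tau>"
proof -
  have "integrable (ivl_measure \<tau>) (\<lambda>t. (norm (k t))\<^sup>2)"
  proof (rule Bochner_Integration.integrable_bound)
    show "integrable (ivl_measure \<tau>) (\<lambda>t. 2 * C\<^sup>2 * ((norm (f t))\<^sup>2 + (norm (g t))\<^sup>2))"
      using assms by (auto simp: L2_def)
    have "norm ((norm (k t))\<^sup>2) \<le> norm (2 * C\<^sup>2 * ((norm (f t))\<^sup>2 + (norm (g t))\<^sup>2))" for t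
    proof -
      have "(norm (k t))\<^sup>2 \<le> (C * (norm (f t) + norm (g t)))\<^sup>2"
        using assms(4) by (intro power_mono) auto
      also have "\<dots> \<le> 2 * C\<^sup>2 * ((norm (f t))\<^sup>2 + (norm (g t))\<^sup>2)"
      proof -
        have "(norm (f t) + norm (g t))\<^sup>2 \<le> 2 * ((norm (f t))\<^sup>2 + (norm (g t))\<^sup>2)"
          using zero_le_power2[of "norm (f t) - norm (g t)"]
          by (simp add: power2_eq_square algebra_simps)
        then have "C\<^sup>2 * (norm (f t) + norm (g t))\<^sup>2 \<le> C\<^sup>2 * (2 * ((norm (f t))\<^sup>2 + (norm (g t))\<^sup>2))"
          by (rule mult_left_mono) simp
        then show ?thesis by (simp only: power_mult_distrib mult.assoc mult.left_commute[of 2])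
      qed
      finally show ?thesis by simp
    qed
    then show "AE t in ivl_measure \<tau>. norm ((norm (k t))\<^sup>2) \<le> norm (2 * C\<^sup>2 * ((norm (f t))\<^sup>2 + (norm (g t))\<^sup>2))"
      by simp
  qed (use assms(3) in measurable)
  then show ?thesis using assms(3) by (simp add: L2_def)
qed

lemma L2_diff:
  assumes "f \<in> L2 \<tau>" "g \<in> L2 \<tau>"
  shows "(\<lambda>t. f t - g t) \<in> L2 \<tau>"
  by (rule L2_dominated[OF assms, where C = 1])
    (use assms in \<open>auto simp: L2_def norm_triangle_ineq4\<close>)

lemma L2_matrix_vector_mult:
  fixes A :: "real^'m^'n"
  assumes "f \<in> L2 \<tau>"
  shows "(\<lambda>t. A *v f t) \<in> L2 \<tau>"
proof -
  have b: "bounded_linear ((*v) A)" by (rule matrix_vector_mul_bounded_linear)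
  then obtain K where K: "K > 0" "\<And>v. norm (A *v v) \<le> norm v * K"
    using bounded_linear.pos_bounded by blast
  show ?thesis
  proof (rule L2_dominated[OF assms assms, where C = K])
    show "(\<lambda>t. A *v f t) \<in> borel_measurable (ivl_measure \<tau>)"
      using assms borel_measurable_continuous_onI[OF linear_continuous_on[OF b]]
      by (auto simp: L2_def intro: measurable_compose)
    show "norm (A *v f t) \<le> K * (norm (f t) + norm (f t))" for t
    proof -
      have "0 \<le> K * norm (f t)" using K(1) by simp
      then have "norm (A *v f t) \<le> K * norm (f t) + K * norm (f t)"
        using K(2)[of "f t"] unfolding mult.commute[of _ K] by linarith
      then show ?thesis by (simp add: distrib_left)
    qed
  qed (use K in simp)
qed

lemma continuous_L2:
  assumes "continuous_on {0..\<tau>} f"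
  shows "f \<in> L2 \<tau>"
  using assms unfolding L2_def
  by (auto intro!: continuous_imp_measurable_on_sets_lebesgue continuous_imp_integrable_real continuous_intros)

lemma abs_continuous_imp_continuous:
  assumes "abs_continuous_on_ivl \<tau> f"
  shows "continuous_on {0..\<tau>} f"
  unfolding continuous_on_iff
proof (intro ballI allI impI)
  fix s e :: real assume s: "s \<in> {0..\<tau>}" and "e > 0"
  then obtain \<delta> where "\<delta> > 0" and \<delta>: "\<forall>E. finite E \<and> (\<forall>(u, v)\<in>E. 0 \<le> u \<and> u \<le> v \<and> v \<le> \<tau>) \<and>
        disjoint_family_on (\<lambda>(u, v). {u<..<v}) E \<and> (\<Sum>(u, v)\<in>E. v - u) < \<delta> \<longrightarrow>
        (\<Sum>(u, v)\<in>E. norm (f v - f u)) < e"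
    using assms[unfolded abs_continuous_on_ivl_def, rule_format, of e] by auto
  have "dist (f t) (f s) < e" if t: "t \<in> {0..\<tau>}" and "dist t s < \<delta>" for t
  proof (cases "s \<le> t")
    case True
    then show ?thesis using \<delta>[rule_format, of "{(s, t)}"] s that
      by (auto simp: dist_norm disjoint_family_on_def)
  next
    case False
    then show ?thesis using \<delta>[rule_format, of "{(t, s)}"] s that
      by (auto simp: dist_norm norm_minus_commute disjoint_family_on_def)
  qed
  with \<open>\<delta> > 0\<close> show "\<exists>d>0. \<forall>t\<in>{0..\<tau>}. dist t s < d \<longrightarrow> dist (f t) (f s) < e" by blast
qed

lemma H1_continuous: "f \<in> H1 \<tau> \<Longrightarrow> continuous_on {0..\<tau>} f"
  by (simp add: H1_def abs_continuous_imp_continuous)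

lemma H1_integral_deriv:
  assumes "f \<in> H1 \<tau>" "t \<in> {0..\<tau>}"
  shows "integral {0..t} (ivl_deriv \<tau> f) = f t - f 0"
  using assms abs_continuous_has_integral_deriv[of \<tau> f 0 t]
  by (intro integral_unique) (auto simp: H1_def)

lemma integrable_mult_continuous:
  fixes p :: "real \<Rightarrow> real" and g :: "real \<Rightarrow> 'a::euclidean_space"
  assumes p: "integrable (ivl_measure \<tau>) p" and g: "continuous_on {0..\<tau>} g"
  shows "integrable (ivl_measure \<tau>) (\<lambda>t. p t *\<^sub>R g t)"
proof -
  have gm: "g \<in> borel_measurable (ivl_measure \<tau>)"
    by (rule continuous_imp_measurable_on_sets_lebesgue[OF g]) simp
  have "compact (g ` {0..\<tau>})" by (intro compact_continuous_image g) simp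
  then obtain C where C: "\<And>t. t \<in> {0..\<tau>} \<Longrightarrow> norm (g t) \<le> C"
    using compact_imp_bounded bounded_iff by (metis imageI)
  show ?thesis
  proof (rule Bochner_Integration.integrable_bound)
    show "integrable (ivl_measure \<tau>) (\<lambda>t. C * p t)" using p by simp
    show "AE t in ivl_measure \<tau>. norm (p t *\<^sub>R g t) \<le> norm (C * p t)"
    proof (rule AE_I2)
      fix t assume "t \<in> space (ivl_measure \<tau>)"
      then have "norm (g t) \<le> \<bar>C\<bar>" using C[of t] by auto
      then show "norm (p t *\<^sub>R g t) \<le> norm (C * p t)"
        by (simp add: abs_mult mult.commute[of "\<bar>C\<bar>"] mult_left_mono)
    qed
    show "(\<lambda>t. p t *\<^sub>R g t) \<in> borel_measurable (ivl_measure \<tau>)"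
      using p gm by measurable
  qed
qed

text \<open>Fubini for \<open>p s * f t\<close> on the triangle \<open>s \<le> t\<close>; integration by parts for functions whose derivatives are
merely integrable rests on it.\<close>

lemma integral_swap_triangle:
  fixes p :: "real \<Rightarrow> real" and f :: "real \<Rightarrow> 'a::euclidean_space"
  assumes p: "integrable (ivl_measure \<tau>) p" and f: "integrable (ivl_measure \<tau>) f"
  shows "(LINT t|ivl_measure \<tau>. integral {0..t} p *\<^sub>R f t) = (LINT s|ivl_measure \<tau>. p s *\<^sub>R integral {s..\<tau>} f)"
proof -
  let ?M = "ivl_measure \<tau>"
  interpret M: finite_measure ?M by (rule finite_measure_ivl)
  interpret P: pair_sigma_finite ?M ?M by unfold_locales
  have [measurable]: "p \<in> borel_measurable ?M" "f \<in> borel_measurable ?M" using p f by auto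
  have idm: "(\<lambda>t. t) \<in> borel_measurable ?M"
    by (intro continuous_imp_measurable_on_sets_lebesgue) auto
  have [measurable]: "fst \<in> borel_measurable (?M \<Otimes>\<^sub>M ?M)" "snd \<in> borel_measurable (?M \<Otimes>\<^sub>M ?M)"
    using measurable_compose[OF measurable_fst idm, of ?M] measurable_compose[OF measurable_snd idm, of ?M]
    by simp_all
  define H where "H s t = (if s \<le> t then p s *\<^sub>R f t else 0)" for s t
  have Hm: "case_prod H \<in> borel_measurable (?M \<Otimes>\<^sub>M ?M)"
    unfolding H_def split_def by measurable
  have "integrable (?M \<Otimes>\<^sub>M ?M) (\<lambda>(s, t). p s *\<^sub>R f t)"
  proof (rule P.Fubini_integrable)
    show "(\<lambda>(s, t). p s *\<^sub>R f t) \<in> borel_measurable (?M \<Otimes>\<^sub>M ?M)" by measurable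
    show "integrable ?M (\<lambda>s. LINT t|?M. norm (case (s, t) of (s, t) \<Rightarrow> p s *\<^sub>R f t))"
      using p by simp
    show "AE s in ?M. integrable ?M (\<lambda>t. case (s, t) of (s, t) \<Rightarrow> p s *\<^sub>R f t)"
      using f by simp
  qed
  then have Hi: "integrable (?M \<Otimes>\<^sub>M ?M) (case_prod H)"
    by (rule Bochner_Integration.integrable_bound[OF _ Hm]) (auto simp: H_def)
  have "(LINT s|?M. H s t) = integral {0..t} p *\<^sub>R f t" if "t \<in> {0..\<tau>}" for t
  proof -
    have "(LINT s|?M. H s t) = (LINT s|?M. (if s \<in> {0..t} then p s else 0) *\<^sub>R f t)"
      by (rule Bochner_Integration.integral_cong) (auto simp: H_def)
    also have "\<dots> = (LINT s|?M. (if s \<in> {0..t} then p s else 0)) *\<^sub>R f t"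
    proof (rule integral_scaleR_left)
      have "Measurable.pred ?M (\<lambda>s. s \<in> {0..t})" using idm by measurable
      then show "integrable ?M (\<lambda>s. if s \<in> {0..t} then p s else 0)"
        by (intro Bochner_Integration.integrable_bound[OF p]) auto
    qed
    also have "(LINT s|?M. (if s \<in> {0..t} then p s else 0)) = (LINT s|lebesgue_on {0..t}. p s)"
      using that by (intro integral_restrict) auto
    also have "\<dots> = integral {0..t} p"
      using p that by (intro lebesgue_integral_eq_integral Equivalence_Lebesgue_Henstock_Integration.integrable_subinterval[OF p]) auto
    finally show ?thesis .
  qed
  then have 1: "(LINT t|?M. LINT s|?M. H s t) = (LINT t|?M. integral {0..t} p *\<^sub>R f t)"
    by (intro Bochner_Integration.integral_cong) auto
  have "(LINT t|?M. H s t) = p s *\<^sub>R integral {s..\<tau>} f" if "s \<in> {0..\<tau>}" for s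
  proof -
    have "(LINT t|?M. H s t) = (LINT t|?M. p s *\<^sub>R (if t \<in> {s..\<tau>} then f t else 0))"
      by (rule Bochner_Integration.integral_cong) (auto simp: H_def)
    also have "\<dots> = p s *\<^sub>R (LINT t|?M. (if t \<in> {s..\<tau>} then f t else 0))"
      by simp
    also have "(LINT t|?M. (if t \<in> {s..\<tau>} then f t else 0)) = (LINT t|lebesgue_on {s..\<tau>}. f t)"
      using that by (intro integral_restrict) auto
    also have "\<dots> = integral {s..\<tau>} f"
      using that by (intro lebesgue_integral_eq_integral Equivalence_Lebesgue_Henstock_Integration.integrable_subinterval[OF f]) auto
    finally show ?thesis .
  qed
  then have 2: "(LINT s|?M. LINT t|?M. H s t) = (LINT s|?M. p s *\<^sub>R integral {s..\<tau>} f)"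
    by (intro Bochner_Integration.integral_cong) auto
  show ?thesis using P.Fubini_integral[OF Hi] 1 2 by simp
qed

lemma H10_D:
  assumes "\<phi> \<in> H10 \<tau>"
  shows "\<phi> \<in> H1 \<tau>" "\<phi> 0 = 0" "\<phi> \<tau> = 0" "ivl_deriv \<tau> \<phi> \<in> L2 \<tau>" "integrable (ivl_measure \<tau>) (ivl_deriv \<tau> \<phi>)"
  using assms L2_integrable by (auto simp: H10_def H1_def)

lemma H10_integral_deriv:
  assumes "\<phi> \<in> H10 \<tau>" "\<tau> > 0"
  shows "(LINT t|ivl_measure \<tau>. ivl_deriv \<tau> \<phi> t) = 0"
  using H1_integral_deriv[OF H10_D(1), OF assms(1), of \<tau>] H10_D[OF assms(1)] assms(2)
  by (simp add: lebesgue_integral_eq_integral)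

lemma H10_deriv_const:
  assumes "\<phi> \<in> H10 \<tau>" "\<tau> > 0"
  shows "(LINT t|ivl_measure \<tau>. ivl_deriv \<tau> \<phi> t *\<^sub>R (v::'a::euclidean_space)) = 0"
  using H10_D(5)[OF assms(1)] H10_integral_deriv[OF assms] by simp

lemma H10_deriv_integrable:
  fixes g :: "real \<Rightarrow> 'a::euclidean_space"
  assumes "\<phi> \<in> H10 \<tau>" "continuous_on {0..\<tau>} g"
  shows "integrable (ivl_measure \<tau>) (\<lambda>t. ivl_deriv \<tau> \<phi> t *\<^sub>R g t)"
  by (rule integrable_mult_continuous[OF H10_D(5)[OF assms(1)] assms(2)])

lemma primitive_continuous:
  fixes f :: "real \<Rightarrow> 'a::euclidean_space"
  assumes "integrable (ivl_measure \<tau>) f"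
  shows "continuous_on {0..\<tau>} (\<lambda>t. integral {0..t} f)"
  by (intro indefinite_integral_continuous_1 integrable_on_lebesgue_on assms) auto

text \<open>Write \<open>\<phi> t\<close> as the integral of its derivative and exchange the integrals. The boundary values of \<open>\<phi>\<close> make its
derivative orthogonal to constants, so the tail integral of \<open>f\<close> may be replaced by minus its primitive.\<close>

lemma integral_by_parts:
  fixes f :: "real \<Rightarrow> 'a::euclidean_space"
  assumes \<phi>: "\<phi> \<in> H10 \<tau>" and f: "integrable (ivl_measure \<tau>) f" and "\<tau> > 0"
  shows "(LINT t|ivl_measure \<tau>. \<phi> t *\<^sub>R f t) = - (LINT t|ivl_measure \<tau>. ivl_deriv \<tau> \<phi> t *\<^sub>R integral {0..t} f)"
proof -
  let ?p = "ivl_deriv \<tau> \<phi>"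
  have "(LINT t|ivl_measure \<tau>. \<phi> t *\<^sub>R f t) = (LINT t|ivl_measure \<tau>. integral {0..t} ?p *\<^sub>R f t)"
    using H1_integral_deriv[OF H10_D(1)[OF \<phi>]] H10_D(2)[OF \<phi>]
    by (intro Bochner_Integration.integral_cong) auto
  also have "\<dots> = (LINT s|ivl_measure \<tau>. ?p s *\<^sub>R integral {s..\<tau>} f)"
    by (rule integral_swap_triangle[OF H10_D(5)[OF \<phi>] f])
  also have "\<dots> = (LINT s|ivl_measure \<tau>. ?p s *\<^sub>R integral {0..\<tau>} f - ?p s *\<^sub>R integral {0..s} f)"
  proof (rule Bochner_Integration.integral_cong[OF refl])
    fix s assume "s \<in> space (ivl_measure \<tau>)"
    then have "integral {0..s} f + integral {s..\<tau>} f = integral {0..\<tau>} f"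
      by (intro Henstock_Kurzweil_Integration.integral_combine integrable_on_lebesgue_on f) auto
    then show "?p s *\<^sub>R integral {s..\<tau>} f = ?p s *\<^sub>R integral {0..\<tau>} f - ?p s *\<^sub>R integral {0..s} f"
      by (metis add_diff_cancel_left' scaleR_diff_right)
  qed
  also have "\<dots> = (LINT s|ivl_measure \<tau>. ?p s *\<^sub>R integral {0..\<tau>} f) - (LINT s|ivl_measure \<tau>. ?p s *\<^sub>R integral {0..s} f)"
    using H10_D(5)[OF \<phi>] H10_deriv_integrable[OF \<phi> primitive_continuous[OF f]]
    by (intro Bochner_Integration.integral_diff) auto
  finally show ?thesis by (simp add: H10_deriv_const[OF \<phi> \<open>\<tau> > 0\<close>])
qed

section \<open>Adjoints of synthesis operators\<close>

text \<open>Both synthesis and differentiated synthesis operators have the form of integration of \<open>- \<phi>'\<close> against a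
continuous function; the former by integration by parts. In this form their adjoints are explicit, and
continuity of the function makes \<open>T\<^sup>* v\<close> continuously differentiable.\<close>

definition represents :: "real \<Rightarrow> ((real \<Rightarrow> real) \<Rightarrow> 'a) \<Rightarrow> (real \<Rightarrow> 'a::euclidean_space) \<Rightarrow> bool" where
  "represents \<tau> T g \<longleftrightarrow> continuous_on {0..\<tau>} g \<and>
     (\<forall>\<phi>\<in>H10 \<tau>. T \<phi> = - (LINT t|ivl_measure \<tau>. ivl_deriv \<tau> \<phi> t *\<^sub>R g t))"

text \<open>The derivatives of elements of \<open>H10\<close> have mean zero, so only the projection of the
representing function to mean zero matters.\<close>

definition centred :: "real \<Rightarrow> (real \<Rightarrow> 'a::euclidean_space) \<Rightarrow> real \<Rightarrow> 'a" where
  "centred \<tau> g t = g t - (1 / \<tau>) *\<^sub>R integral {0..\<tau>} g"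

lemma represents_diff_synthesis: "x \<in> H1 \<tau> \<Longrightarrow> represents \<tau> (diff_synthesis \<tau> x) x"
  by (simp add: represents_def diff_synthesis_def H1_continuous)

lemma represents_synthesis:
  assumes "f \<in> L2 \<tau>" "\<tau> > 0"
  shows "represents \<tau> (synthesis \<tau> f) (\<lambda>t. integral {0..t} f)"
  using integral_by_parts[OF _ L2_integrable[OF assms(1)] assms(2)] primitive_continuous[OF L2_integrable[OF assms(1)]]
  by (simp add: represents_def synthesis_def)

lemma centred_continuous: "continuous_on {0..\<tau>} g \<Longrightarrow> continuous_on {0..\<tau>} (centred \<tau> g)"
  unfolding centred_def by (intro continuous_intros)

lemma integral_centred:
  assumes "continuous_on {0..\<tau>} g" "\<tau> > 0"
  shows "integral {0..\<tau>} (centred \<tau> g) = 0"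
proof -
  have "integral {0..\<tau>} (centred \<tau> g) = integral {0..\<tau>} g - integral {0..\<tau>} (\<lambda>t. (1 / \<tau>) *\<^sub>R integral {0..\<tau>} g)"
    unfolding centred_def
    by (intro Henstock_Kurzweil_Integration.integral_diff integrable_continuous_real assms continuous_intros)
  then show ?thesis using assms(2) by simp
qed

text \<open>A primitive of a continuous function is Lipschitz, hence absolutely continuous.\<close>

lemma primitive_in_H10:
  fixes k :: "real \<Rightarrow> real"
  assumes k: "continuous_on {0..\<tau>} k" and "\<tau> > 0" and "integral {0..\<tau>} k = 0"
  shows "(\<lambda>t. integral {0..t} k) \<in> H10 \<tau>"
    and "\<And>t. t \<in> {0..\<tau>} \<Longrightarrow> ivl_deriv \<tau> (\<lambda>t. integral {0..t} k) t = k t"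
proof -
  let ?K = "\<lambda>t. integral {0..t} k"
  have d: "(?K has_vector_derivative k t) (at t within {0..\<tau>})" if "t \<in> {0..\<tau>}" for t
    by (rule integral_has_vector_derivative[OF k that])
  show deriv: "ivl_deriv \<tau> ?K t = k t" if "t \<in> {0..\<tau>}" for t
    unfolding ivl_deriv_def by (rule vector_derivative_within_closed_interval[OF \<open>\<tau> > 0\<close> that d[OF that]])
  have "compact (k ` {0..\<tau>})" by (intro compact_continuous_image k) simp
  then obtain C where C: "\<And>t. t \<in> {0..\<tau>} \<Longrightarrow> norm (k t) \<le> C"
    using compact_imp_bounded bounded_iff by (metis imageI)
  have "C \<ge> 0" using C[of 0] \<open>\<tau> > 0\<close> norm_ge_zero[of "k 0"] by fastforce
  have lip: "norm (?K v - ?K u) \<le> C * (v - u)" if "0 \<le> u" "u \<le> v" "v \<le> \<tau>" for u v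
  proof -
    have "?K u + integral {u..v} k = ?K v"
      using that continuous_on_subset[OF k]
      by (intro Henstock_Kurzweil_Integration.integral_combine integrable_continuous_real) auto
    then have "?K v - ?K u = integral {u..v} k" by simp
    also have "norm \<dots> \<le> C * (v - u)"
      using that continuous_on_subset[OF k] by (intro integral_bound C) auto
    finally show ?thesis .
  qed
  have "abs_continuous_on_ivl \<tau> ?K"
    unfolding abs_continuous_on_ivl_def
  proof (intro allI impI)
    fix e :: real assume "e > 0"
    show "\<exists>\<delta>>0. \<forall>D. finite D \<and> (\<forall>(a, b)\<in>D. 0 \<le> a \<and> a \<le> b \<and> b \<le> \<tau>) \<and>
        disjoint_family_on (\<lambda>(a, b). {a<..<b}) D \<and> (\<Sum>(a, b)\<in>D. b - a) < \<delta>
        \<longrightarrow> (\<Sum>(a, b)\<in>D. norm (?K b - ?K a)) < e"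
    proof (intro exI[of _ "e / (C + 1)"] conjI allI impI)
      show "e / (C + 1) > 0" using \<open>e > 0\<close> \<open>C \<ge> 0\<close> by simp
      fix D :: "(real \<times> real) set" assume D: "finite D \<and> (\<forall>(a, b)\<in>D. 0 \<le> a \<and> a \<le> b \<and> b \<le> \<tau>) \<and>
        disjoint_family_on (\<lambda>(a, b). {a<..<b}) D \<and> (\<Sum>(a, b)\<in>D. b - a) < e / (C + 1)"
      have "(\<Sum>(a, b)\<in>D. norm (?K b - ?K a)) \<le> (\<Sum>(a, b)\<in>D. C * (b - a))"
        using D by (intro sum_mono) (auto simp del: real_norm_def intro!: lip)
      also have "\<dots> = C * (\<Sum>(a, b)\<in>D. b - a)"
        by (simp add: split_def sum_distrib_left)
      also have "\<dots> \<le> C * (e / (C + 1))"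
        using D \<open>C \<ge> 0\<close> by (intro mult_left_mono) auto
      also have "\<dots> < e" using \<open>e > 0\<close> \<open>C \<ge> 0\<close> by (simp add: field_simps)
      finally show "(\<Sum>(a, b)\<in>D. norm (?K b - ?K a)) < e" .
    qed
  qed
  moreover have "AE t in ivl_measure \<tau>. ?K differentiable (at t within {0..\<tau>})"
    using d by (intro AE_I2) (auto simp: differentiable_def has_vector_derivative_def)
  moreover have "ivl_deriv \<tau> ?K \<in> L2 \<tau>"
  proof -
    have "ivl_deriv \<tau> ?K \<in> borel_measurable (ivl_measure \<tau>) \<longleftrightarrow> k \<in> borel_measurable (ivl_measure \<tau>)"
      by (rule measurable_cong) (simp add: deriv)
    moreover have "integrable (ivl_measure \<tau>) (\<lambda>t. (norm (ivl_deriv \<tau> ?K t))\<^sup>2)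
        \<longleftrightarrow> integrable (ivl_measure \<tau>) (\<lambda>t. (norm (k t))\<^sup>2)"
      by (rule Bochner_Integration.integrable_cong) (simp_all add: deriv)
    ultimately show ?thesis using continuous_L2[OF k] by (simp add: L2_def)
  qed
  ultimately show "?K \<in> H10 \<tau>"
    using assms(3) by (simp add: H10_def H1_def)
qed

lemma L2_integrable_mult:
  fixes f g :: "real \<Rightarrow> real"
  assumes "f \<in> L2 \<tau>" "g \<in> L2 \<tau>"
  shows "integrable (ivl_measure \<tau>) (\<lambda>t. f t * g t)"
proof (rule Bochner_Integration.integrable_bound)
  show "integrable (ivl_measure \<tau>) (\<lambda>t. (norm (f t))\<^sup>2 + (norm (g t))\<^sup>2)"
    using assms by (auto simp: L2_def)
  have "norm (a * b) \<le> norm ((norm a)\<^sup>2 + (norm b)\<^sup>2)" for a b :: real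
  proof -
    have "0 \<le> (\<bar>a\<bar> - \<bar>b\<bar>)\<^sup>2" by simp
    then have "2 * (\<bar>a\<bar> * \<bar>b\<bar>) \<le> a\<^sup>2 + b\<^sup>2" by (simp add: power2_eq_square algebra_simps)
    moreover have "0 \<le> \<bar>a\<bar> * \<bar>b\<bar>" by simp
    ultimately have "\<bar>a\<bar> * \<bar>b\<bar> \<le> a\<^sup>2 + b\<^sup>2" by linarith
    then show ?thesis by (simp add: abs_mult)
  qed
  then show "AE t in ivl_measure \<tau>. norm (f t * g t) \<le> norm ((norm (f t))\<^sup>2 + (norm (g t))\<^sup>2)"
    by (intro AE_I2)
  show "(\<lambda>t. f t * g t) \<in> borel_measurable (ivl_measure \<tau>)"
    using assms by (auto simp: L2_def)
qed

text \<open>The two elements are compared by testing only against themselves: expanding the integral of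
\<open>(\<psi>' - \<eta>')\<^sup>2\<close> gives four inner products that cancel. The lemma gives the uniqueness of the adjoint.\<close>

lemma H10_inner_determines_deriv:
  assumes "\<psi> \<in> H10 \<tau>" "\<eta> \<in> H10 \<tau>" and eq: "\<And>\<phi>. \<phi> \<in> H10 \<tau> \<Longrightarrow> H10_inner \<tau> \<phi> \<psi> = H10_inner \<tau> \<phi> \<eta>"
  shows "AE t in ivl_measure \<tau>. ivl_deriv \<tau> \<psi> t = ivl_deriv \<tau> \<eta> t"
proof -
  let ?p = "ivl_deriv \<tau> \<psi>" and ?r = "ivl_deriv \<tau> \<eta>"
  have L: "?p \<in> L2 \<tau>" "?r \<in> L2 \<tau>" using assms H10_D by blast+
  note int = L2_integrable_mult[OF L(1) L(1)] L2_integrable_mult[OF L(1) L(2)]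
    L2_integrable_mult[OF L(2) L(1)] L2_integrable_mult[OF L(2) L(2)]
  have expand: "(?p t - ?r t)\<^sup>2 = (?p t * ?p t - ?p t * ?r t) - (?r t * ?p t - ?r t * ?r t)" for t
    by (simp add: power2_eq_square algebra_simps)
  have "(LINT t|ivl_measure \<tau>. (?p t - ?r t)\<^sup>2)
      = (H10_inner \<tau> \<psi> \<psi> - H10_inner \<tau> \<psi> \<eta>) - (H10_inner \<tau> \<eta> \<psi> - H10_inner \<tau> \<eta> \<eta>)"
    unfolding expand H10_inner_def using int by (simp add: mult.commute)
  also have "\<dots> = 0" using eq assms(1,2) by simp
  finally have "(LINT t|ivl_measure \<tau>. (?p t - ?r t)\<^sup>2) = 0" .
  moreover have "integrable (ivl_measure \<tau>) (\<lambda>t. (?p t - ?r t)\<^sup>2)"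
    unfolding expand using int by simp
  ultimately have "AE t in ivl_measure \<tau>. (?p t - ?r t)\<^sup>2 = 0"
    by (simp add: integral_nonneg_eq_0_iff_AE)
  then show ?thesis by eventually_elim simp
qed

text \<open>The candidate for \<open>T\<^sup>* v\<close> is the primitive of \<open>- (centred \<tau> g \<bullet> v)\<close>, which vanishes at both ends because
the integrand has mean zero. Whatever the choice operator selects has the same derivative almost everywhere.\<close>

lemma H10_adjoint_deriv:
  assumes T: "represents \<tau> T g" and "\<tau> > 0"
  shows "H10_adjoint \<tau> T v \<in> H10 \<tau>"
    and "AE t in ivl_measure \<tau>. ivl_deriv \<tau> (H10_adjoint \<tau> T v) t = - (centred \<tau> g t \<bullet> v)"
proof -
  have g: "continuous_on {0..\<tau>} g" using T by (simp add: represents_def)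
  define k where "k t = - (centred \<tau> g t \<bullet> v)" for t
  have k: "continuous_on {0..\<tau>} k"
    unfolding k_def by (intro continuous_intros centred_continuous g)
  have "integral {0..\<tau>} k = - (integral {0..\<tau>} (centred \<tau> g) \<bullet> v)"
    unfolding k_def
    using integral_linear[OF integrable_continuous_real[OF centred_continuous[OF g]] bounded_linear_inner_left[of v]]
    by (simp add: o_def)
  then have k0: "integral {0..\<tau>} k = 0" using integral_centred[OF g \<open>\<tau> > 0\<close>] by simp
  define \<eta> where "\<eta> t = integral {0..t} k" for t
  note \<eta> = primitive_in_H10[OF k \<open>\<tau> > 0\<close> k0, folded \<eta>_def]
  \<comment> \<open>Subtracting the mean of \<open>g\<close> changes nothing, since \<open>\<phi>'\<close> integrates to zero.\<close>
  have rep: "T \<phi> \<bullet> v = H10_inner \<tau> \<phi> \<eta>" if \<phi>: "\<phi> \<in> H10 \<tau>" for \<phi>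
  proof -
    let ?m = "(1 / \<tau>) *\<^sub>R integral {0..\<tau>} g"
    have "T \<phi> \<bullet> v = - ((LINT t|ivl_measure \<tau>. ivl_deriv \<tau> \<phi> t *\<^sub>R g t)
        - (LINT t|ivl_measure \<tau>. ivl_deriv \<tau> \<phi> t *\<^sub>R ?m)) \<bullet> v"
      using T \<phi> by (simp only: represents_def H10_deriv_const[OF \<phi> \<open>\<tau> > 0\<close>]) simp
    also have "(LINT t|ivl_measure \<tau>. ivl_deriv \<tau> \<phi> t *\<^sub>R g t) - (LINT t|ivl_measure \<tau>. ivl_deriv \<tau> \<phi> t *\<^sub>R ?m)
        = (LINT t|ivl_measure \<tau>. ivl_deriv \<tau> \<phi> t *\<^sub>R centred \<tau> g t)"
      unfolding centred_def scaleR_diff_right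
      by (intro Bochner_Integration.integral_diff[symmetric] H10_deriv_integrable[OF \<phi>] g continuous_on_const)
    also have "- \<dots> \<bullet> v = (LINT t|ivl_measure \<tau>. - ((ivl_deriv \<tau> \<phi> t *\<^sub>R centred \<tau> g t) \<bullet> v))"
      using H10_deriv_integrable[OF \<phi> centred_continuous[OF g]] by (simp del: inner_scaleR_left)
    also have "\<dots> = H10_inner \<tau> \<phi> \<eta>"
      unfolding H10_inner_def
      by (rule Bochner_Integration.integral_cong) (simp_all add: \<eta>(2) k_def)
    finally show ?thesis .
  qed
  have "H10_adjoint \<tau> T v \<in> H10 \<tau> \<and> (\<forall>\<phi>\<in>H10 \<tau>. T \<phi> \<bullet> v = H10_inner \<tau> \<phi> (H10_adjoint \<tau> T v))"
    unfolding H10_adjoint_def by (rule someI[of _ \<eta>]) (use \<eta>(1) rep in blast)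
  then show 1: "H10_adjoint \<tau> T v \<in> H10 \<tau>"
    and 2: "AE t in ivl_measure \<tau>. ivl_deriv \<tau> (H10_adjoint \<tau> T v) t = - (centred \<tau> g t \<bullet> v)"
  proof -
    assume *: "H10_adjoint \<tau> T v \<in> H10 \<tau> \<and> (\<forall>\<phi>\<in>H10 \<tau>. T \<phi> \<bullet> v = H10_inner \<tau> \<phi> (H10_adjoint \<tau> T v))"
    then have "AE t in ivl_measure \<tau>. ivl_deriv \<tau> (H10_adjoint \<tau> T v) t = ivl_deriv \<tau> \<eta> t"
      using rep by (intro H10_inner_determines_deriv \<eta>(1)) auto
    then have "AE t in ivl_measure \<tau>. t \<in> {0..\<tau>} \<longrightarrow> ivl_deriv \<tau> (H10_adjoint \<tau> T v) t = - (centred \<tau> g t \<bullet> v)"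
      by eventually_elim (simp add: \<eta>(2) k_def)
    then show "AE t in ivl_measure \<tau>. ivl_deriv \<tau> (H10_adjoint \<tau> T v) t = - (centred \<tau> g t \<bullet> v)"
      using AE_space by eventually_elim simp
  qed simp
qed

lemma centred_product_integrable:
  fixes g :: "real \<Rightarrow> 'a::euclidean_space" and h :: "real \<Rightarrow> 'b::euclidean_space"
  assumes "continuous_on {0..\<tau>} g" "continuous_on {0..\<tau>} h"
  shows "integrable (ivl_measure \<tau>) (\<lambda>t. (centred \<tau> g t \<bullet> v) *\<^sub>R h t)"
  by (intro continuous_imp_integrable_real continuous_intros centred_continuous assms)

lemma synthesis_adjoint:
  fixes S :: "(real \<Rightarrow> real) \<Rightarrow> real^'j" and T :: "(real \<Rightarrow> real) \<Rightarrow> real^'k"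
  assumes S: "represents \<tau> S h" and T: "represents \<tau> T g" and "\<tau> > 0"
  shows "S (H10_adjoint \<tau> T v) = (LINT t|ivl_measure \<tau>. (centred \<tau> g t \<bullet> v) *\<^sub>R h t)"
proof -
  let ?p = "ivl_deriv \<tau> (H10_adjoint \<tau> T v)"
  have gh: "continuous_on {0..\<tau>} g" "continuous_on {0..\<tau>} h" using S T by (auto simp: represents_def)
  note adj = H10_adjoint_deriv[OF T \<open>\<tau> > 0\<close>, of v]
  have "S (H10_adjoint \<tau> T v) = - (LINT t|ivl_measure \<tau>. ?p t *\<^sub>R h t)"
    using S adj(1) by (simp add: represents_def)
  also have "(LINT t|ivl_measure \<tau>. ?p t *\<^sub>R h t) = (LINT t|ivl_measure \<tau>. - ((centred \<tau> g t \<bullet> v) *\<^sub>R h t))"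
  proof (rule integral_cong_AE)
    show "(\<lambda>t. ?p t *\<^sub>R h t) \<in> borel_measurable (ivl_measure \<tau>)"
      by (rule borel_measurable_integrable[OF H10_deriv_integrable[OF adj(1) gh(2)]])
    show "(\<lambda>t. - ((centred \<tau> g t \<bullet> v) *\<^sub>R h t)) \<in> borel_measurable (ivl_measure \<tau>)"
      by (intro borel_measurable_uminus borel_measurable_integrable[OF centred_product_integrable[OF gh]])
    show "AE t in ivl_measure \<tau>. ?p t *\<^sub>R h t = - ((centred \<tau> g t \<bullet> v) *\<^sub>R h t)"
      using adj(2) by eventually_elim simp
  qed
  finally show ?thesis by simp
qed

text \<open>The matrix \<open>S T\<^sup>*\<close> is the Gram matrix of the centred representing functions. Through
this formula the operators enter only as a positive semidefinite form on a finite-dimensional space.\<close>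

lemma inner_mult_adj:
  fixes S :: "(real \<Rightarrow> real) \<Rightarrow> real^'j" and T :: "(real \<Rightarrow> real) \<Rightarrow> real^'k"
  assumes S: "represents \<tau> S h" and T: "represents \<tau> T g" and "\<tau> > 0"
  shows "w \<bullet> (mult_adj \<tau> S T *v v) = (LINT t|ivl_measure \<tau>. (centred \<tau> h t \<bullet> w) * (centred \<tau> g t \<bullet> v))"
proof -
  have gh: "continuous_on {0..\<tau>} g" "continuous_on {0..\<tau>} h" using S T by (auto simp: represents_def)
  note int = centred_product_integrable[OF gh]
  let ?m = "(1 / \<tau>) *\<^sub>R integral {0..\<tau>} h"
  have "linear (\<lambda>v. S (H10_adjoint \<tau> T v))"
    by (rule linearI)
      (simp_all add: synthesis_adjoint[OF assms] inner_add_right scaleR_add_left int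
        flip: scaleR_scaleR integral_scaleR_right)
  then have "mult_adj \<tau> S T *v v = S (H10_adjoint \<tau> T v)"
    unfolding mult_adj_def by (simp add: matrix_works linear_matrix_vector_mul_eq)
  also have "\<dots> = (LINT t|ivl_measure \<tau>. (centred \<tau> g t \<bullet> v) *\<^sub>R h t)" by (rule synthesis_adjoint[OF assms])
  \<comment> \<open>The subtracted integral vanishes, as \<open>centred \<tau> g\<close> has mean zero; it serves to centre \<open>h\<close> as well.\<close>
  also have "\<dots> = (LINT t|ivl_measure \<tau>. (centred \<tau> g t \<bullet> v) *\<^sub>R h t) - (LINT t|ivl_measure \<tau>. (centred \<tau> g t \<bullet> v) *\<^sub>R ?m)"
  proof -
    have "(LINT t|ivl_measure \<tau>. centred \<tau> g t) = 0"
      using integral_centred[OF gh(1) \<open>\<tau> > 0\<close>] continuous_imp_integrable_real[OF centred_continuous[OF gh(1)]]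
      by (simp add: lebesgue_integral_eq_integral)
    then have "(LINT t|ivl_measure \<tau>. centred \<tau> g t \<bullet> v) = 0"
      using continuous_imp_integrable_real[OF centred_continuous[OF gh(1)]] by simp
    then have "(LINT t|ivl_measure \<tau>. (centred \<tau> g t \<bullet> v) *\<^sub>R ?m) = 0"
      using continuous_imp_integrable_real[OF centred_continuous[OF gh(1)]] by simp
    then show ?thesis by simp
  qed
  also have "\<dots> = (LINT t|ivl_measure \<tau>. (centred \<tau> g t \<bullet> v) *\<^sub>R centred \<tau> h t)"
    unfolding centred_def[of \<tau> h] scaleR_diff_right
    by (intro Bochner_Integration.integral_diff[symmetric] centred_product_integrable gh continuous_on_const)
  finally have "w \<bullet> (mult_adj \<tau> S T *v v) = w \<bullet> (LINT t|ivl_measure \<tau>. (centred \<tau> g t \<bullet> v) *\<^sub>R centred \<tau> h t)"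
    by simp
  also have "\<dots> = (LINT t|ivl_measure \<tau>. w \<bullet> ((centred \<tau> g t \<bullet> v) *\<^sub>R centred \<tau> h t))"
    using centred_product_integrable[OF gh(1) centred_continuous[OF gh(2)]]
    by (simp del: inner_scaleR_right)
  also have "\<dots> = (LINT t|ivl_measure \<tau>. (centred \<tau> h t \<bullet> w) * (centred \<tau> g t \<bullet> v))"
    by (simp add: inner_commute mult.commute)
  finally show ?thesis .
qed

section \<open>The S-lemma\<close>

text \<open>The multiplier must satisfy \<open>\<alpha> \<le> f z z / g z z\<close> where \<open>g z z > 0\<close> and the reverse inequality where \<open>g z z < 0\<close>, so
the claim is that every quotient of the first kind dominates every quotient of the second kind. On the line
\<open>z1 + t z2\<close> through one point of each kind, \<open>g\<close> is a quadratic with two roots of opposite sign, at which \<open>f\<close>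
is nonnegative. The positive combination of these two inequalities that cancels the mixed term of \<open>f\<close> is the
required comparison.\<close>

lemma S_lemma:
  fixes f g :: "'v::real_vector \<Rightarrow> 'v \<Rightarrow> real"
  assumes f: "bilinear f" "\<And>a b. f a b = f b a"
    and g: "bilinear g" "\<And>a b. g a b = g b a"
    and imp: "\<And>z. g z z \<ge> 0 \<Longrightarrow> f z z \<ge> 0"
    and slater: "g z0 z0 > 0"
  shows "\<exists>\<alpha>\<ge>0. \<forall>z. f z z \<ge> \<alpha> * g z z"
proof -
  have cross: "f z1 z1 * g z2 z2 \<le> g z1 z1 * f z2 z2" if "g z1 z1 > 0" "g z2 z2 < 0" for z1 z2
  proof -
    have line: "h (z1 + t *\<^sub>R z2) (z1 + t *\<^sub>R z2) = h z1 z1 + 2 * t * h z1 z2 + t\<^sup>2 * h z2 z2"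
      if "bilinear h" "\<And>a b. h a b = h b a" for h :: "'v \<Rightarrow> 'v \<Rightarrow> real" and t
      using that
      by (simp add: bilinear_ladd bilinear_radd bilinear_lmul bilinear_rmul power2_eq_square algebra_simps)
    define G1 G2 b where "G1 = g z1 z1" "G2 = g z2 z2" "b = g z1 z2"
    define s where "s = sqrt (b\<^sup>2 - G1 * G2)"
    have G: "G1 > 0" "G2 < 0" using that by (auto simp: G1_G2_b_def)
    then have "G1 * G2 < 0" by (simp add: mult_pos_neg)
    then have "b\<^sup>2 - G1 * G2 \<ge> 0" using zero_le_power2[of b] by linarith
    then have s2: "s\<^sup>2 = b\<^sup>2 - G1 * G2" by (simp add: s_def)
    have "b\<^sup>2 < s\<^sup>2" using \<open>G1 * G2 < 0\<close> by (simp add: s2)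
    moreover have "s \<ge> 0" using \<open>b\<^sup>2 - G1 * G2 \<ge> 0\<close> by (simp add: s_def)
    ultimately have bs: "\<bar>b\<bar> < s" by (metis abs_le_square_iff abs_of_nonneg linorder_not_le)
    define t1 where "t1 = (- b - s) / G2"
    define t2 where "t2 = (- b + s) / G2"
    have t: "t1 > 0" "t2 < 0" using bs G by (auto simp: t1_def t2_def divide_simps)
    have root: "G1 + 2 * t1 * b + t1\<^sup>2 * G2 = 0" "G1 + 2 * t2 * b + t2\<^sup>2 * G2 = 0"
    proof -
      have "G2 * t1 = - b - s" "G2 * t2 = - b + s" using G by (simp_all add: t1_def t2_def)
      then have "G2 * (G1 + 2 * t1 * b + t1\<^sup>2 * G2) = 0" "G2 * (G1 + 2 * t2 * b + t2\<^sup>2 * G2) = 0"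
        using s2 by algebra+
      then show "G1 + 2 * t1 * b + t1\<^sup>2 * G2 = 0" "G1 + 2 * t2 * b + t2\<^sup>2 * G2 = 0"
        using G by auto
    qed
    have prod: "t1 * t2 * G2 = G1"
    proof -
      have "t1 * t2 * G2 = (b\<^sup>2 - s\<^sup>2) / G2"
        using G by (simp add: t1_def t2_def field_simps power2_eq_square)
      then show ?thesis using G by (simp add: s2)
    qed
    have f1: "f z1 z1 + 2 * t1 * f z1 z2 + t1\<^sup>2 * f z2 z2 \<ge> 0"
      using imp[of "z1 + t1 *\<^sub>R z2"] root by (simp add: line f g G1_G2_b_def)
    have f2: "f z1 z1 + 2 * t2 * f z1 z2 + t2\<^sup>2 * f z2 z2 \<ge> 0"
      using imp[of "z1 + t2 *\<^sub>R z2"] root by (simp add: line f g G1_G2_b_def)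
    \<comment> \<open>The weights \<open>- t2\<close> and \<open>t1\<close> are positive and cancel the coefficient of \<open>f z1 z2\<close>.\<close>
    have "0 \<le> - t2 * (f z1 z1 + 2 * t1 * f z1 z2 + t1\<^sup>2 * f z2 z2)
        + t1 * (f z1 z1 + 2 * t2 * f z1 z2 + t2\<^sup>2 * f z2 z2)"
      using mult_nonneg_nonneg[OF _ f1, of "- t2"] mult_nonneg_nonneg[OF _ f2, of t1] t
      by (intro add_nonneg_nonneg) auto
    also have "\<dots> = (t1 - t2) * (f z1 z1 - t1 * t2 * f z2 z2)"
      by (simp add: algebra_simps power2_eq_square)
    finally have "f z1 z1 - t1 * t2 * f z2 z2 \<ge> 0"
      using t by (simp add: zero_le_mult_iff)
    then have "(f z1 z1 - t1 * t2 * f z2 z2) * G2 \<le> 0"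
      using G by (simp add: mult_nonneg_nonpos)
    then have "f z1 z1 * G2 \<le> t1 * t2 * G2 * f z2 z2" by (simp add: algebra_simps)
    then show ?thesis unfolding prod by (simp add: G1_G2_b_def)
  qed
  \<comment> \<open>The infimum of these quotients is the largest admissible multiplier.\<close>
  define A where "A = {f z z / g z z | z. g z z > 0}"
  have A0: "a \<ge> 0" if "a \<in> A" for a
    using that imp by (auto simp: A_def less_imp_le)
  then have bdd: "bdd_below A" by (intro bdd_belowI)
  have ne: "A \<noteq> {}" using slater by (auto simp: A_def)
  have "f z z \<ge> Inf A * g z z" for z
  proof (cases "g z z" "0::real" rule: linorder_cases)
    case less
    have "f z z / g z z \<le> Inf A"
      by (rule cInf_greatest[OF ne]) (use cross less in \<open>auto simp: A_def field_simps\<close>)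
    then show ?thesis using less by (simp add: field_simps)
  next
    case equal
    then show ?thesis using imp[of z] by simp
  next
    case greater
    then have "Inf A \<le> f z z / g z z"
      by (intro cInf_lower bdd) (auto simp: A_def)
    then show ?thesis using greater by (simp add: field_simps)
  qed
  moreover have "Inf A \<ge> 0" by (rule cInf_greatest[OF ne A0])
  ultimately show ?thesis by blast
qed

locale psd_form =
  fixes B :: "'v::real_vector \<Rightarrow> 'v \<Rightarrow> real"
  assumes bilinear: "bilinear B" and sym: "B z w = B w z" and nonneg: "B z z \<ge> 0"
begin

lemmas bilin = bilinear_ladd[OF bilinear] bilinear_radd[OF bilinear] bilinear_lsub[OF bilinear]
  bilinear_rsub[OF bilinear] bilinear_lmul[OF bilinear, unfolded real_scaleR_def]
  bilinear_rmul[OF bilinear, unfolded real_scaleR_def]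
  bilinear_lneg[OF bilinear] bilinear_rneg[OF bilinear] bilinear_lzero[OF bilinear] bilinear_rzero[OF bilinear]

lemma expand: "B (z + t *\<^sub>R w) (z + t *\<^sub>R w) = B z z + 2 * t * B z w + t\<^sup>2 * B w w"
  using sym[of w z] by (simp add: bilin power2_eq_square algebra_simps)

text \<open>Otherwise \<open>B (z + t w) (z + t w)\<close> would be a nonconstant affine function of \<open>t\<close>, and the \<open>t\<close> used in the
proof makes it \<open>- 1\<close>.\<close>

lemma null_orthogonal:
  assumes "B w w = 0"
  shows "B z w = 0"
proof (rule ccontr)
  assume n: "B z w \<noteq> 0"
  have "0 \<le> B (z + (- (B z z + 1) / (2 * B z w)) *\<^sub>R w) (z + (- (B z z + 1) / (2 * B z w)) *\<^sub>R w)"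
    by (rule nonneg)
  also have "\<dots> = -1" using n assms by (simp only: expand) (simp add: field_simps)
  finally show False by simp
qed

lemma Cauchy_Schwarz: "(B z w)\<^sup>2 \<le> B z z * B w w"
proof (cases "B w w = 0")
  case True
  then show ?thesis by (simp add: null_orthogonal)
next
  case False
  then have pos: "B w w > 0" using nonneg[of w] by simp
  have "0 \<le> B (z + (- B z w / B w w) *\<^sub>R w) (z + (- B z w / B w w) *\<^sub>R w)" by (rule nonneg)
  also have "\<dots> = B z z - (B z w)\<^sup>2 / B w w"
    using pos by (simp only: expand) (simp add: field_simps power2_eq_square)
  finally show ?thesis using pos by (simp add: field_simps)
qed

end

section \<open>A matrix S-lemma for degenerate forms\<close>

text \<open>An abstract quadratic matrix inequality. A pair of vectors \<open>(x, y)\<close> has the score \<open>q x y\<close>, and a linear map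
\<open>Z\<close> satisfies the inequality if its whole graph has nonnegative score. In the application \<open>Z\<close> maps \<open>x\<close> to
\<open>(A\<^sup>T x, B\<^sup>T x)\<close>, and the form measures the noise that the system \<open>(A, B)\<close> needs to
explain the data. It may be degenerate, so the set of feasible maps may be unbounded.\<close>

locale qmi = psd_form B for B :: "('e::euclidean_space \<times> 'f::euclidean_space) \<Rightarrow> 'e \<times> 'f \<Rightarrow> real" +
  fixes c :: real
begin

definition q :: "'e \<Rightarrow> 'f \<Rightarrow> real" where
  "q x y = c * (x \<bullet> x) - B (x, y) (x, y)"

definition feasible :: "('e \<Rightarrow> 'f) \<Rightarrow> bool" where
  "feasible Z \<longleftrightarrow> linear Z \<and> (\<forall>x. q x (Z x) \<ge> 0)"

definition h :: "'f \<Rightarrow> real" where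
  "h y = B (0, y) (0, y)"

lemma h_nonneg: "h y \<ge> 0"
  by (simp add: h_def nonneg)

lemma h_scaleR: "h (r *\<^sub>R y) = r\<^sup>2 * h y"
proof -
  have "(0::'e, r *\<^sub>R y) = r *\<^sub>R (0, y)" by simp
  then show ?thesis by (simp only: h_def bilin power2_eq_square mult.assoc)
qed

lemma Pair_split: "(x, y + z) = (x, y) + (0, z)" for x :: 'e and y z :: 'f
  by simp

lemma q_add_null:
  assumes "h k = 0"
  shows "q x (y + k) = q x y"
  using assms null_orthogonal[of "(0, k)" "(x, y)"] sym[of "(0, k)" "(x, y)"]
  by (simp add: q_def h_def Pair_split bilin del: add_Pair)

text \<open>The normal equations for minimising \<open>B (x, y) (x, y)\<close> over \<open>y\<close>. They are solvable although \<open>B\<close> may be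
degenerate in \<open>y\<close>: the component \<open>k\<close> of their right-hand side \<open>g\<close> orthogonal to the range of the operator \<open>G\<close>
lies in the null space of \<open>h\<close>, is therefore \<open>B\<close>-orthogonal to everything, and so vanishes.\<close>

lemma centre_pointwise: "\<exists>y. \<forall>z. B (x, y) (0, z) = 0"
proof -
  define G where "G y = (\<Sum>b\<in>Basis. B (0, y) (0, b) *\<^sub>R b)" for y :: 'f
  define g where "g = (\<Sum>b\<in>Basis. B (x, 0) (0, b) *\<^sub>R b)"
  have lin0: "linear (\<lambda>z. B p (0, z))" for p
  proof (rule linearI)
    show "B p (0, y + z) = B p (0, y) + B p (0, z)" for y z
      using bilinear_radd[OF bilinear, of p "(0, y)" "(0, z)"] by simp
    show "B p (0, r *\<^sub>R z) = r *\<^sub>R B p (0, z)" for r z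
      using bilinear_rmul[OF bilinear, of p r "(0, z)"] by simp
  qed
  have rep: "(\<Sum>b\<in>Basis. B p (0, b) *\<^sub>R b) \<bullet> z = B p (0, z)" for p z
  proof -
    have "B p (0, z) = B p (0, \<Sum>b\<in>Basis. (z \<bullet> b) *\<^sub>R b)" by (simp add: euclidean_representation)
    also have "\<dots> = (\<Sum>b\<in>Basis. (z \<bullet> b) * B p (0, b))"
      using linear_sum[OF lin0[of p], of "\<lambda>b. (z \<bullet> b) *\<^sub>R b" Basis]
      by (simp add: linear_cmul[OF lin0[of p], simplified])
    finally show ?thesis by (simp add: inner_sum_left) (simp add: inner_commute mult.commute)
  qed
  have G: "G y \<bullet> z = B (0, y) (0, z)" for y z by (simp add: G_def rep)
  have g: "g \<bullet> z = B (x, 0) (0, z)" for z by (simp add: g_def rep)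
  have "linear G"
  proof (rule linearI)
    show "G (y + z) = G y + G z" for y z
      by (rule vector_eq_rdot[THEN iffD1]) (use bilinear_ladd[OF bilinear, of "(0, y)" "(0, z)"] in \<open>simp add: G inner_add_left\<close>)
    show "G (r *\<^sub>R y) = r *\<^sub>R G y" for r y
      by (rule vector_eq_rdot[THEN iffD1]) (use bilinear_lmul[OF bilinear, of r "(0, y)"] in \<open>simp add: G\<close>)
  qed
  obtain p k where p: "p \<in> span (range G)" and k: "\<And>w. w \<in> span (range G) \<Longrightarrow> orthogonal k w"
    and gpk: "g = p + k"
    using orthogonal_subspace_decomp_exists[of "range G" g] by blast
  have "G z \<bullet> k = 0" for z
    using k[of "G z"] by (simp add: span_base orthogonal_def inner_commute)
  then have "B (0, z) (0, k) = 0" for z by (simp add: G)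
  then have "h k = 0" by (simp add: h_def)
  then have "g \<bullet> k = 0" using null_orthogonal by (simp add: g h_def)
  moreover have "p \<bullet> k = 0" using k[OF p] by (simp add: orthogonal_def inner_commute)
  ultimately have "k = 0" by (simp add: gpk inner_add_left)
  moreover have "span (range G) = range G"
    using linear_subspace_image[OF \<open>linear G\<close> subspace_UNIV] by (simp add: span_eq_iff)
  ultimately have "g \<in> range G" using p gpk by (metis add.right_neutral)
  then obtain y where y: "g = G y" by blast
  have "B (x, - y) (0, z) = 0" for z
  proof -
    have "B (x, - y) (0, z) = B ((x, 0) - (0, y)) (0, z)" by simp
    also have "\<dots> = g \<bullet> z - G y \<bullet> z" by (simp only: bilin g G)
    finally show ?thesis by (simp add: y)
  qed
  then show ?thesis by blast
qed

lemma centre: "\<exists>Z. linear Z \<and> (\<forall>x z. B (x, Z x) (0, z) = 0)"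
proof -
  obtain Y where Y: "\<And>x z. B (x, Y x) (0, z) = 0" using centre_pointwise by metis
  define Z where "Z x = (\<Sum>b\<in>Basis. (x \<bullet> b) *\<^sub>R Y b)" for x
  have "linear Z"
    by (rule linearI) (simp_all add: Z_def inner_add_left scaleR_add_left sum.distrib scaleR_sum_right)
  moreover have "B (x, Z x) (0, z) = 0" for x z
  proof -
    have "B (x, Z x) (0, z) = B (\<Sum>b\<in>Basis. (x \<bullet> b) *\<^sub>R (b, Y b)) (0, z)"
      by (rule arg_cong[where f = "\<lambda>p. B p (0, z)"], rule prod_eqI)
        (simp_all add: Z_def euclidean_representation fst_sum snd_sum)
    also have "\<dots> = (\<Sum>b\<in>Basis. B ((x \<bullet> b) *\<^sub>R (b, Y b)) (0, z))"
      using bilinear by (intro linear_sum) (simp add: bilinear_def)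
    also have "\<dots> = 0" by (simp only: bilin Y) simp
    finally show ?thesis .
  qed
  ultimately show ?thesis by blast
qed

text \<open>Completing the square around the centre \<open>C\<close> turns the score into \<open>q a (C a + d) = \<sigma> a a - h d\<close>, where \<open>\<sigma>\<close>, the
Schur complement, is positive semidefinite because a feasible map exists. A rank-one correction of \<open>C\<close> moves
the value at \<open>x\<close> to \<open>y\<close>. Taken in the direction of the functional \<open>\<sigma> x\<close>, it stays feasible by the
Cauchy-Schwarz inequality for \<open>\<sigma>\<close>; if \<open>\<sigma> x x = 0\<close>, the correction has \<open>h d = 0\<close> and any functional will do.
This is what reduces an inequality over all feasible matrices to one over vectors.\<close>

lemma interpolation:
  assumes feas: "feasible Z0" and xy: "q x y \<ge> 0" and "x \<noteq> 0"
  shows "\<exists>Z. feasible Z \<and> Z x = y"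
proof -
  obtain C where "linear C" and C: "\<And>x z. B (x, C x) (0, z) = 0" using centre by blast
  define \<sigma> where "\<sigma> a b = c * (a \<bullet> b) - B (a, C a) (b, C b)" for a b
  have q_eq: "q a (C a + d) = \<sigma> a a - h d" for a d
    using C[of a d] sym[of "(0, d)" "(a, C a)"]
    by (simp add: q_def \<sigma>_def h_def Pair_split bilin del: add_Pair)
  interpret \<sigma>: psd_form \<sigma>
  proof
    have lC: "(a + b, C (a + b)) = (a, C a) + (b, C b)" "(r *\<^sub>R a, C (r *\<^sub>R a)) = r *\<^sub>R (a, C a)" for a b r
      using \<open>linear C\<close> by (simp_all add: linear_add linear_cmul)
    show "bilinear \<sigma>"
      unfolding bilinear_def linear_iff
      by (simp add: \<sigma>_def lC bilin inner_add_left inner_add_right algebra_simps del: add_Pair scaleR_Pair)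
    show "\<sigma> a b = \<sigma> b a" for a b
      by (simp add: \<sigma>_def inner_commute sym)
    show "\<sigma> a a \<ge> 0" for a
    proof -
      have "0 \<le> q a (C a + (Z0 a - C a))" using feas by (simp add: feasible_def)
      then show ?thesis using h_nonneg[of "Z0 a - C a"] by (simp only: q_eq)
    qed
  qed
  define d where "d = y - C x"
  have s: "\<sigma> x x - h d \<ge> 0" using xy q_eq[of x d] by (simp add: d_def)
  show ?thesis
  proof (cases "\<sigma> x x = 0")
    case True
    then have "h d = 0" using s h_nonneg[of d] by simp
    define Z where "Z z = C z + ((x \<bullet> z) / (x \<bullet> x)) *\<^sub>R d" for z
    have "linear Z" unfolding Z_def
      by (rule linearI) (simp_all add: linear_add[OF \<open>linear C\<close>] linear_cmul[OF \<open>linear C\<close>]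
          inner_add_right add_divide_distrib algebra_simps)
    moreover have "q z (Z z) \<ge> 0" for z
      by (simp add: Z_def q_eq h_scaleR \<open>h d = 0\<close> \<sigma>.nonneg)
    moreover have "Z x = y" using \<open>x \<noteq> 0\<close> by (simp add: Z_def d_def)
    ultimately show ?thesis by (auto simp: feasible_def)
  next
    case False
    then have pos: "\<sigma> x x > 0" using \<sigma>.nonneg[of x] by simp
    define Z where "Z z = C z + (\<sigma> x z / \<sigma> x x) *\<^sub>R d" for z
    have "linear Z" unfolding Z_def
      by (rule linearI) (simp_all add: linear_add[OF \<open>linear C\<close>] linear_cmul[OF \<open>linear C\<close>]
          \<sigma>.bilin add_divide_distrib algebra_simps)
    moreover have "q z (Z z) \<ge> 0" for z
    proof -
      have "(\<sigma> x z / \<sigma> x x)\<^sup>2 * h d \<le> (\<sigma> x z / \<sigma> x x)\<^sup>2 * \<sigma> x x"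
        using s by (intro mult_left_mono) auto
      also have "\<dots> = (\<sigma> x z)\<^sup>2 / \<sigma> x x" using pos by (simp add: field_simps power2_eq_square)
      also have "\<dots> \<le> \<sigma> z z" using \<sigma>.Cauchy_Schwarz[of x z] pos by (simp add: field_simps)
      finally show ?thesis by (simp add: Z_def q_eq h_scaleR)
    qed
    moreover have "Z x = y" using pos by (simp add: Z_def d_def)
    ultimately show ?thesis by (auto simp: feasible_def)
  qed
qed

text \<open>Directions with \<open>h k = 0\<close> can be added to a feasible map in any amount. A strict inequality that is affine in
that amount can only persist if its slope vanishes.\<close>

lemma multiplier_annihilates_null:
  assumes feas: "feasible Z0" and neg: "\<And>Z x. feasible Z \<Longrightarrow> x \<noteq> 0 \<Longrightarrow> R x \<bullet> Z x < 0"
    and "linear R" and "h k = 0"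
  shows "R x \<bullet> k = 0"
proof (rule ccontr)
  assume n: "R x \<bullet> k \<noteq> 0"
  then have "x \<noteq> 0" using \<open>linear R\<close> by (auto simp: linear_0)
  \<comment> \<open>The amount of the direction \<open>k\<close> at which \<open>R x \<bullet> Z x\<close> becomes zero.\<close>
  define t where "t = - (R x \<bullet> Z0 x) / ((x \<bullet> x) * (R x \<bullet> k))"
  define Z where "Z z = Z0 z + (t * (x \<bullet> z)) *\<^sub>R k" for z
  have Z0: "linear Z0" using feas by (simp add: feasible_def)
  have hs: "h (r *\<^sub>R k) = 0" for r by (simp add: h_scaleR \<open>h k = 0\<close>)
  have "linear Z" unfolding Z_def
    by (rule linearI) (simp_all add: linear_add[OF Z0] linear_cmul[OF Z0] inner_add_right algebra_simps)
  moreover have "q z (Z z) \<ge> 0" for z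
    using feas by (simp add: Z_def q_add_null hs feasible_def)
  ultimately have "R x \<bullet> Z x < 0" by (intro neg \<open>x \<noteq> 0\<close>) (simp add: feasible_def)
  moreover have "R x \<bullet> Z x = 0"
    using n \<open>x \<noteq> 0\<close> by (simp add: Z_def inner_add_right inner_diff_right t_def)
  ultimately show False by simp
qed

lemma closed_null_complement: "closed {y. \<forall>k. h k = 0 \<longrightarrow> y \<bullet> k = 0}"
proof -
  have "{y. \<forall>k. h k = 0 \<longrightarrow> y \<bullet> k = 0} = (\<Inter>k\<in>{k. h k = 0}. {y. y \<bullet> k = 0})" by auto
  moreover have "closed {y. y \<bullet> k = 0}" for k :: 'f
    by (intro closed_Collect_eq continuous_intros)
  ultimately show ?thesis by auto
qed

lemma h_coercive: "\<exists>\<delta>>0. \<forall>y. (\<forall>k. h k = 0 \<longrightarrow> y \<bullet> k = 0) \<longrightarrow> \<delta> * (norm y)\<^sup>2 \<le> h y"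
proof -
  define V where "V = {y. \<forall>k. h k = 0 \<longrightarrow> y \<bullet> k = 0}"
  have "closed V" unfolding V_def by (rule closed_null_complement)
  then have "compact (sphere 0 1 \<inter> V)" by (intro compact_Int_closed) auto
  moreover have ch: "continuous_on (sphere 0 1 \<inter> V) h"
    unfolding h_def by (intro bilinear_continuous_on_compose[OF _ _ bilinear] continuous_intros)
  ultimately consider "sphere 0 1 \<inter> V = {}" | y0 where "y0 \<in> sphere 0 1 \<inter> V" "\<And>y. y \<in> sphere 0 1 \<inter> V \<Longrightarrow> h y0 \<le> h y"
    using continuous_attains_inf[of "sphere 0 1 \<inter> V" h] by metis
  then obtain \<delta> where "\<delta> > 0" and \<delta>: "\<And>y. y \<in> sphere 0 1 \<inter> V \<Longrightarrow> \<delta> \<le> h y"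
  proof cases
    case 1
    then show ?thesis using that[of 1] by auto
  next
    case 2
    have "h y0 \<noteq> 0"
    proof
      assume "h y0 = 0"
      then have "y0 \<bullet> y0 = 0" using 2(1) by (auto simp: V_def)
      then show False using 2(1) by auto
    qed
    then show ?thesis using that[of "h y0"] 2 h_nonneg[of y0] by auto
  qed
  have "\<delta> * (norm y)\<^sup>2 \<le> h y" if "\<forall>k. h k = 0 \<longrightarrow> y \<bullet> k = 0" for y
  proof (cases "y = 0")
    case True
    then show ?thesis using h_nonneg by simp
  next
    case False
    then have "(1 / norm y) *\<^sub>R y \<in> sphere 0 1 \<inter> V" using that by (auto simp: V_def)
    from \<delta>[OF this] show ?thesis using False by (simp add: h_scaleR field_simps)
  qed
  with \<open>\<delta> > 0\<close> show ?thesis by blast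
qed

text \<open>Three steps. First, strictness is made uniform: the function \<open>f = max (- 2 (R x \<bullet> y)) (- q x y)\<close> is positive
for \<open>x \<noteq> 0\<close> by interpolation, and on the compact set \<open>S\<close> it has a positive minimum \<open>m\<close>. Here \<open>S\<close> is restricted to the
complement \<open>V\<close> of the null space of \<open>h\<close>, where \<open>h\<close> is coercive; this loses nothing, since null directions
affect neither \<open>q\<close> nor \<open>R x \<bullet> y\<close>. Second, it follows that \<open>- 2 (R x \<bullet> y) \<ge> m (x \<bullet> x)\<close> even where \<open>q x y\<close> is
only at least \<open>- \<kappa> (x \<bullet> x)\<close>. Third, for the form \<open>q x y + \<kappa> (x \<bullet> x)\<close> relaxed in this way any feasible map
provides a Slater point, so the S-lemma applies. For \<open>q\<close> itself there may be none, for instance when \<open>c = 0\<close>.\<close>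

lemma matrix_S_lemma:
  assumes feas: "feasible Z0" and neg: "\<And>Z x. feasible Z \<Longrightarrow> x \<noteq> 0 \<Longrightarrow> R x \<bullet> Z x < 0"
    and R: "linear R"
  shows "\<exists>\<epsilon>>0. \<exists>\<alpha>\<ge>0. \<forall>x y. - 2 * (R x \<bullet> y) - \<epsilon> * (x \<bullet> x) \<ge> \<alpha> * q x y"
proof -
  define V where "V = {y. \<forall>k. h k = 0 \<longrightarrow> y \<bullet> k = 0}"
  define S where "S = {(x, y). norm x = 1 \<and> y \<in> V \<and> q x y \<ge> -1}"
  define f where "f = (\<lambda>(x, y). max (- 2 * (R x \<bullet> y)) (- q x y))"
  obtain \<delta> where "\<delta> > 0" and \<delta>: "\<And>y. y \<in> V \<Longrightarrow> \<delta> * (norm y)\<^sup>2 \<le> h y"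
    using h_coercive unfolding V_def by blast
  obtain M where M: "\<And>z w. norm (B z w) \<le> M * norm z * norm w"
    using bilinear_bounded[OF bilinear] by blast
  have contB: "continuous_on T (\<lambda>p. B (g p) (k p))" if "continuous_on T g" "continuous_on T k"
    for T and g k :: "'e \<times> 'f \<Rightarrow> 'e \<times> 'f"
    by (intro bilinear_continuous_on_compose[OF that bilinear])
  have contR: "continuous_on T (\<lambda>p. R (g p))" if "continuous_on T g" for T and g :: "'e \<times> 'f \<Rightarrow> 'e"
    using continuous_on_compose2[OF linear_continuous_on[OF linear_conv_bounded_linear[THEN iffD1, OF R]] that] by blast
  have contq: "continuous_on T (\<lambda>p. q (fst p) (snd p))" for T
    unfolding q_def by (intro continuous_intros contB)
  have "closed V" unfolding V_def by (rule closed_null_complement)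
  have "closed S"
  proof -
    have "S = {p. norm (fst p) = 1} \<inter> (snd -` V \<inter> {p. -1 \<le> q (fst p) (snd p)})"
      by (auto simp: S_def)
    moreover have "closed (snd -` V :: ('e \<times> 'f) set)"
      by (intro closed_vimage \<open>closed V\<close> continuous_on_snd continuous_on_id)
    ultimately show ?thesis
      by (simp add: closed_Int closed_Collect_le closed_Collect_eq contq continuous_on_norm continuous_on_fst)
  qed
  moreover have "bounded S"
  proof (rule boundedI)
    fix p assume "p \<in> S"
    then obtain x y where p: "p = (x, y)" and x: "norm x = 1" and y: "y \<in> V" and q: "q x y \<ge> -1"
      by (auto simp: S_def)
    have xx: "x \<bullet> x = 1" using x by (simp add: dot_square_norm)
    have "B (x, y) (x, y) \<le> c + 1" using q by (simp add: q_def xx)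
    moreover have "B (x, 0) (x, 0) \<le> M"
      using M[of "(x, 0)" "(x, 0)"] x by (simp add: norm_Pair)
    \<comment> \<open>The parallelogram inequality for \<open>(0, y) = (x, y) - (x, 0)\<close>.\<close>
    moreover have "h y \<le> 2 * B (x, y) (x, y) + 2 * B (x, 0) (x, 0)"
    proof -
      have "(0, y) = (x, y) - (x, 0)" by simp
      then have "h y = B (x, y) (x, y) - 2 * B (x, y) (x, 0) + B (x, 0) (x, 0)"
        using sym[of "(x, 0)" "(x, y)"] by (simp only: h_def bilin)
      moreover have "0 \<le> B ((x, y) + (x, 0)) ((x, y) + (x, 0))" by (rule nonneg)
      then have "0 \<le> B (x, y) (x, y) + 2 * B (x, y) (x, 0) + B (x, 0) (x, 0)"
        using sym[of "(x, 0)" "(x, y)"] by (simp only: bilin)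
      ultimately show ?thesis by simp
    qed
    ultimately have "\<delta> * (norm y)\<^sup>2 \<le> 2 * (c + 1) + 2 * M" using \<delta>[OF y] by simp
    then have "(norm y)\<^sup>2 \<le> (2 * (c + 1) + 2 * M) / \<delta>" using \<open>\<delta> > 0\<close> by (simp add: field_simps)
    then show "norm p \<le> sqrt (1 + (2 * (c + 1) + 2 * M) / \<delta>)"
      by (simp add: p norm_Pair x)
  qed
  ultimately have "compact S" by (simp add: compact_eq_bounded_closed)
  have contf: "continuous_on S f"
    unfolding f_def split_def by (intro continuous_intros contR contq)
  have Sf: "f p > 0" if "p \<in> S" for p
  proof -
    obtain x y where p: "p = (x, y)" and "norm x = 1" using \<open>p \<in> S\<close> by (auto simp: S_def)
    then have "x \<noteq> 0" by auto
    show ?thesis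
    proof (cases "q x y \<ge> 0")
      case True
      then have "R x \<bullet> y < 0" using interpolation[OF feas True \<open>x \<noteq> 0\<close>] neg \<open>x \<noteq> 0\<close> by blast
      then show ?thesis by (simp add: f_def p)
    qed (simp add: f_def p)
  qed
  obtain m where "m > 0" and m: "\<And>p. p \<in> S \<Longrightarrow> m \<le> f p"
  proof (cases "S = {}")
    case True
    then show ?thesis using that[of 1] by auto
  next
    case False
    then obtain p where "p \<in> S" "\<And>p'. p' \<in> S \<Longrightarrow> f p \<le> f p'"
      using continuous_attains_inf[OF \<open>compact S\<close> False contf] by blast
    then show ?thesis using that[of "f p"] Sf by blast
  qed
  define \<kappa> where "\<kappa> = min 1 (m / 2)"
  have \<kappa>: "\<kappa> > 0" "\<kappa> \<le> 1" "\<kappa> < m" using \<open>m > 0\<close> by (auto simp: \<kappa>_def)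
  have unit: "- 2 * (R x \<bullet> y) \<ge> m" if "norm x = 1" "q x y \<ge> - \<kappa>" for x y
  proof -
    have "subspace {k. h k = 0}"
    proof (rule subspaceI)
      show "0 \<in> {k. h k = 0}" by (simp add: h_def bilin flip: zero_prod_def)
      show "k + l \<in> {k. h k = 0}" if "k \<in> {k. h k = 0}" "l \<in> {k. h k = 0}" for k l
        using that q_add_null[of l 0 k] by (simp add: q_def h_def)
    qed (simp add: h_scaleR)
    then obtain k v where k: "h k = 0" and v: "\<And>w. h w = 0 \<Longrightarrow> orthogonal v w" and y: "y = k + v"
      using orthogonal_subspace_decomp_exists[of "{k. h k = 0}" y] by (auto simp: span_eq_iff[THEN iffD2])
    have qv: "q x y = q x v" using q_add_null[OF k, of x v] by (simp add: y add.commute)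
    have Rv: "R x \<bullet> y = R x \<bullet> v"
      using multiplier_annihilates_null[where R = R and x = x, OF feas _ R k] neg
      by (simp add: y inner_add_right)
    have "(x, v) \<in> S"
      using that qv v \<kappa> by (auto simp: S_def V_def orthogonal_def)
    then have "m \<le> f (x, v)" by (rule m)
    moreover have "- q x v < m" using that qv \<kappa> by simp
    ultimately show ?thesis by (simp add: f_def Rv)
  qed
  have imp: "- 2 * (R x \<bullet> y) \<ge> m * (x \<bullet> x)" if q: "q x y + \<kappa> * (x \<bullet> x) \<ge> 0" for x y
  proof (cases "x = 0")
    case True
    then show ?thesis using R by (simp add: linear_0)
  next
    case False
    define r where "r = 1 / norm x"
    have "r > 0" using False by (simp add: r_def)
    have "q (r *\<^sub>R x) (r *\<^sub>R y) = r\<^sup>2 * q x y"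
    proof -
      have "(r *\<^sub>R x, r *\<^sub>R y) = r *\<^sub>R (x, y)" by simp
      then show ?thesis by (simp only: q_def bilin) (simp add: algebra_simps power2_eq_square)
    qed
    moreover have rx: "r\<^sup>2 * (x \<bullet> x) = 1"
      using False by (simp add: r_def power_divide dot_square_norm)
    moreover have "0 \<le> r\<^sup>2 * (q x y + \<kappa> * (x \<bullet> x))" using q by simp
    ultimately have "q (r *\<^sub>R x) (r *\<^sub>R y) \<ge> - \<kappa>" by (simp add: algebra_simps)
    moreover have "norm (r *\<^sub>R x) = 1" using False by (simp add: r_def)
    ultimately have "m \<le> - 2 * (R (r *\<^sub>R x) \<bullet> (r *\<^sub>R y))" by (intro unit)
    also have "\<dots> = r\<^sup>2 * (- 2 * (R x \<bullet> y))"
      by (simp add: linear_cmul[OF R] power2_eq_square)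
    finally have "r\<^sup>2 * (m * (x \<bullet> x)) \<le> r\<^sup>2 * (- 2 * (R x \<bullet> y))"
      using rx by (simp add: algebra_simps)
    then show ?thesis using \<open>r > 0\<close> by (subst (asm) mult_le_cancel_left_pos) auto
  qed
  \<comment> \<open>The two forms of the S-lemma, in polarised form.\<close>
  define F where "F z w = - (R (fst z) \<bullet> snd w) - (R (fst w) \<bullet> snd z) - m * (fst z \<bullet> fst w)" for z w
  define G where "G z w = (c + \<kappa>) * (fst z \<bullet> fst w) - B z w" for z w
  have Gq: "G z z = q (fst z) (snd z) + \<kappa> * (fst z \<bullet> fst z)" for z
    by (simp add: G_def q_def algebra_simps)
  have FR: "F z z = - 2 * (R (fst z) \<bullet> snd z) - m * (fst z \<bullet> fst z)" for z
    by (simp add: F_def)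
  obtain b :: 'e where b: "b \<in> Basis" using nonempty_Basis by blast
  have "\<exists>\<alpha>\<ge>0. \<forall>z. F z z \<ge> \<alpha> * G z z"
  proof (rule S_lemma[where f = F and g = G])
    show "bilinear F"
      unfolding bilinear_def linear_iff
      by (simp add: F_def linear_add[OF R] linear_cmul[OF R] inner_add_left inner_add_right algebra_simps)
    show "bilinear G"
      unfolding bilinear_def linear_iff
      by (simp add: G_def bilin inner_add_left inner_add_right algebra_simps)
    show "F z w = F w z" "G z w = G w z" for z w
      by (simp_all add: F_def G_def inner_commute sym)
    show "F z z \<ge> 0" if "G z z \<ge> 0" for z
      using imp that by (simp add: Gq FR)
    show "G (b, Z0 b) (b, Z0 b) > 0"
      using feas b \<kappa> by (simp add: Gq feasible_def add_nonneg_pos)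
  qed
  then obtain \<alpha> where "\<alpha> \<ge> 0" and \<alpha>: "\<And>z. F z z \<ge> \<alpha> * G z z" by blast
  have "- 2 * (R x \<bullet> y) - m * (x \<bullet> x) \<ge> \<alpha> * q x y" for x y
  proof -
    have "\<alpha> * q x y \<le> \<alpha> * G (x, y) (x, y)"
      using \<open>\<alpha> \<ge> 0\<close> \<kappa> by (intro mult_left_mono) (simp_all add: Gq)
    also have "\<dots> \<le> F (x, y) (x, y)" by (rule \<alpha>)
    finally show ?thesis by (simp add: FR)
  qed
  with \<open>m > 0\<close> \<open>\<alpha> \<ge> 0\<close> show ?thesis by blast
qed

end

section \<open>Block matrices and Lyapunov inequalities\<close>

lemma sum_UNIV_sum:
  fixes f :: "'a::finite + 'b::finite \<Rightarrow> 'c::comm_monoid_add"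
  shows "(\<Sum>i\<in>UNIV. f i) = (\<Sum>i\<in>UNIV. f (Inl i)) + (\<Sum>i\<in>UNIV. f (Inr i))"
  by (simp add: sum.Plus flip: UNIV_Plus_UNIV)

definition join3 :: "real^'a \<Rightarrow> real^'b \<Rightarrow> real^'c \<Rightarrow> real^('a + 'b + 'c)" where
  "join3 x y z = (\<chi> i. case i of Inl k \<Rightarrow> x $ k | Inr (Inl k) \<Rightarrow> y $ k | Inr (Inr k) \<Rightarrow> z $ k)"

lemma join3_exhaust: "\<exists>x y z. v = join3 x y z"
proof -
  have "v = join3 (\<chi> k. v $ Inl k) (\<chi> k. v $ Inr (Inl k)) (\<chi> k. v $ Inr (Inr k))"
    by (simp add: join3_def vec_eq_iff split: sum.split)
  then show ?thesis by blast
qed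

lemma block3_quadratic_form:
  "join3 x y z \<bullet> (block3 M11 M12 M13 M21 M22 M23 M31 M32 M33 *v join3 x y z) =
     x \<bullet> (M11 *v x) + x \<bullet> (M12 *v y) + x \<bullet> (M13 *v z) +
     y \<bullet> (M21 *v x) + y \<bullet> (M22 *v y) + y \<bullet> (M23 *v z) +
     z \<bullet> (M31 *v x) + z \<bullet> (M32 *v y) + z \<bullet> (M33 *v z)"
  unfolding join3_def block3_def inner_vec_def matrix_vector_mult_def
  by (simp add: sum_UNIV_sum sum.distrib distrib_left)

lemma transpose_block3:
  "transpose (block3 M11 M12 M13 M21 M22 M23 M31 M32 M33) =
     block3 (transpose M11) (transpose M21) (transpose M31)
            (transpose M12) (transpose M22) (transpose M32)
            (transpose M13) (transpose M23) (transpose M33)"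
  by (simp add: block3_def transpose_def vec_eq_iff split: sum.split)

lemma pos_def_invertible:
  assumes "pos_def P"
  shows "invertible P"
proof -
  have "P *v v = 0 \<Longrightarrow> v = 0" for v
    using assms unfolding pos_def_def by (metis inner_zero_right less_irrefl)
  then show ?thesis by (simp add: invertible_left_inverse matrix_left_invertible_ker)
qed

lemma inner_transpose: "x \<bullet> (transpose M *v y) = (M *v x) \<bullet> y" for M :: "real^'a^'b"
  by (metis dot_lmul_matrix inner_commute transpose_matrix_vector)

lemma uminus_matrix_vector_mult: "(- M) *v v = - (M *v v)" for M :: "real^'a^'b"
  by (simp add: matrix_vector_mult_def vec_eq_iff sum_negf)

text \<open>For an eigenvector \<open>v = a + i b\<close> put \<open>w = P\<inverse> v\<close>. The sum of the Lyapunov expression over the real and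
imaginary parts \<open>p\<close>, \<open>r\<close> of \<open>w\<close> is \<open>Re z\<close> times the positive number \<open>p \<bullet> P p + r \<bullet> P r\<close>; the imaginary
part of the eigenvalue drops out by symmetry of \<open>P\<close>.\<close>

lemma lyapunov_hurwitz:
  assumes P: "pos_def P" and M: "\<And>v. v \<noteq> 0 \<Longrightarrow> v \<bullet> (M *v (P *v v)) < 0"
  shows "hurwitz M"
  unfolding hurwitz_def eigenvalue_def
proof (intro allI impI, elim exE conjE)
  fix z v assume "v \<noteq> 0" and ev: "map_matrix complex_of_real M *v v = z *s v"
  define a where "a = (\<chi> i. Re (v $ i))"
  define b where "b = (\<chi> i. Im (v $ i))"
  have comp: "(\<Sum>j\<in>UNIV. complex_of_real (M $ i $ j) * v $ j) = z * v $ i" for i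
    using ev by (simp add: vec_eq_iff matrix_vector_mult_def map_matrix_def)
  have a: "M *v a = Re z *\<^sub>R a - Im z *\<^sub>R b"
  proof -
    have "(\<Sum>j\<in>UNIV. M $ i $ j * Re (v $ j)) = Re z * Re (v $ i) - Im z * Im (v $ i)" for i
      using arg_cong[OF comp[of i], of Re] by simp
    then show ?thesis by (simp add: vec_eq_iff matrix_vector_mult_def a_def b_def)
  qed
  have b: "M *v b = Im z *\<^sub>R a + Re z *\<^sub>R b"
  proof -
    have "(\<Sum>j\<in>UNIV. M $ i $ j * Im (v $ j)) = Re z * Im (v $ i) + Im z * Re (v $ i)" for i
      using arg_cong[OF comp[of i], of Im] by simp
    then show ?thesis by (simp add: vec_eq_iff matrix_vector_mult_def a_def b_def)
  qed
  have "\<exists>p. P *v p = w" for w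
    using pos_def_invertible[OF P] matrix_right_invertible_surjective[of P] invertible_right_inverse[of P]
    by (metis surjD)
  then obtain p r where p: "P *v p = a" and r: "P *v r = b" by metis
  have sym: "p \<bullet> b = r \<bullet> a"
  proof -
    have "transpose P = P" using P by (simp add: pos_def_def)
    from inner_transpose[of p P r, unfolded this] show ?thesis by (simp add: p r inner_commute)
  qed
  have "a \<noteq> 0 \<or> b \<noteq> 0"
    using \<open>v \<noteq> 0\<close> by (auto simp: a_def b_def vec_eq_iff complex_eq_iff)
  then have "p \<noteq> 0 \<or> r \<noteq> 0" using p r by auto
  have le: "w \<bullet> (M *v (P *v w)) \<le> 0" "w \<bullet> (P *v w) \<ge> 0" for w
    using M[of w] P by (cases "w = 0"; simp add: pos_def_def less_imp_le)+
  have "p \<bullet> (M *v (P *v p)) + r \<bullet> (M *v (P *v r)) < 0"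
    using \<open>p \<noteq> 0 \<or> r \<noteq> 0\<close> M[of p] M[of r] le(1)[of p] le(1)[of r] by linarith
  also have "p \<bullet> (M *v (P *v p)) + r \<bullet> (M *v (P *v r)) = Re z * (p \<bullet> (P *v p) + r \<bullet> (P *v r))"
    unfolding p r a b using sym by (simp add: inner_diff_right inner_add_right algebra_simps)
  finally show "Re z < 0"
    using le(2)[of p] le(2)[of r] by (simp add: mult_less_0_iff)
qed

lemma pos_def_lyapunov_iff:
  fixes P M :: "real^'n^'n"
  assumes "transpose P = P"
  shows "pos_def (- (M ** P) - P ** transpose M) \<longleftrightarrow> (\<forall>v. v \<noteq> 0 \<longrightarrow> v \<bullet> (M *v (P *v v)) < 0)"
proof -
  have "transpose (- (M ** P) - P ** transpose M) = - (M ** P) - P ** transpose M"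
  proof -
    have "transpose (- X - Y) = - transpose X - transpose Y" for X Y :: "real^'n^'n"
      by (simp add: transpose_def vec_eq_iff)
    then have "transpose (- (M ** P) - P ** transpose M) = - (P ** transpose M) - M ** P"
      by (simp only: matrix_transpose_mul assms transpose_transpose)
    then show ?thesis by simp
  qed
  moreover have "v \<bullet> ((- (M ** P) - P ** transpose M) *v v) = - 2 * (v \<bullet> (M *v (P *v v)))" for v
  proof -
    have "v \<bullet> ((P ** transpose M) *v v) = v \<bullet> ((M ** P) *v v)"
      using inner_transpose[of v "M ** P" v] by (simp only: matrix_transpose_mul assms inner_commute)
    then show ?thesis
      by (simp only: matrix_vector_mult_diff_rdistrib uminus_matrix_vector_mult inner_diff_right
          inner_minus_right matrix_vector_mul_assoc)
  qed
  ultimately show ?thesis by (simp add: pos_def_def)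
qed

section \<open>Data-driven stabilization as a quadratic matrix inequality\<close>

lemma integral_matrix_vector_mult:
  fixes A :: "real^'m^'n"
  assumes "f integrable_on S"
  shows "integral S (\<lambda>t. A *v f t) = A *v integral S f"
  using integral_linear[OF assms matrix_vector_mul_bounded_linear[of A]] by (simp add: o_def)

lemma integrable_matrix_vector_mult:
  fixes A :: "real^'m^'n"
  assumes "f integrable_on S"
  shows "(\<lambda>t. A *v f t) integrable_on S"
  using integrable_linear[OF assms matrix_vector_mul_bounded_linear[of A]] by (simp add: o_def)

text \<open>Integrating the system equation shows that the primitive of the noise differs from the stated function only by
the constant \<open>x 0\<close>, which is invisible to derivatives of functions in \<open>H10\<close>. Equivalently
\<open>W = X\<^sub>d - A X - B U\<close> as operators.\<close>

lemma represents_noise: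
  fixes x :: "real \<Rightarrow> real^'n" and u :: "real \<Rightarrow> real^'m"
  assumes x: "x \<in> H1 \<tau>" and u: "u \<in> L2 \<tau>" and w: "w \<in> L2 \<tau>"
    and sys: "satisfies_system \<tau> A B x u w" and "\<tau> > 0"
  shows "represents \<tau> (synthesis \<tau> w)
    (\<lambda>t. x t - A *v integral {0..t} x - B *v integral {0..t} u)"
proof -
  have xc: "continuous_on {0..\<tau>} x" by (rule H1_continuous[OF x])
  have prim: "integral {0..t} w = x t - A *v integral {0..t} x - B *v integral {0..t} u - x 0"
    if t: "t \<in> {0..\<tau>}" for t
  proof -
    let ?x' = "ivl_deriv \<tau> x"
    have on: "f integrable_on {0..t}" if "integrable (ivl_measure \<tau>) f" for f :: "real \<Rightarrow> 'a::euclidean_space"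
      using that t by (intro integrable_on_lebesgue_on Equivalence_Lebesgue_Henstock_Integration.integrable_subinterval[OF that]) auto
    have xi: "x integrable_on {0..t}" by (intro on continuous_imp_integrable_real xc)
    have ui: "u integrable_on {0..t}" by (intro on L2_integrable u)
    have di: "?x' integrable_on {0..t}" using x by (intro on L2_integrable) (simp add: H1_def)
    have "AE t in lebesgue. t \<notin> {s \<in> {0..\<tau>}. ?x' s \<noteq> A *v x s + B *v u s + w s}"
      using sys by (auto simp: satisfies_system_def AE_restrict_space_iff elim!: eventually_mono)
    then obtain N where N: "N \<in> null_sets lebesgue" "{s \<in> {0..\<tau>}. ?x' s \<noteq> A *v x s + B *v u s + w s} \<subseteq> N"
      by (auto simp: eventually_ae_filter)
    have "integral {0..t} w = integral {0..t} (\<lambda>s. ?x' s - A *v x s - B *v u s)"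
    proof (rule integral_spike)
      show "negligible N" using N by (simp add: negligible_iff_null_sets)
      show "?x' s - A *v x s - B *v u s = w s" if "s \<in> {0..t} - N" for s
      proof -
        have "?x' s = A *v x s + B *v u s + w s" using that N t by auto
        then show ?thesis by simp
      qed
    qed
    also have "\<dots> = integral {0..t} ?x' - A *v integral {0..t} x - B *v integral {0..t} u"
      using xi ui di
      by (simp add: Henstock_Kurzweil_Integration.integral_diff integrable_diff integrable_matrix_vector_mult integral_matrix_vector_mult)
    finally show ?thesis using H1_integral_deriv[OF x t] by simp
  qed
  let ?g = "\<lambda>t. x t - A *v integral {0..t} x - B *v integral {0..t} u"
  have g: "continuous_on {0..\<tau>} ?g"
    by (intro continuous_intros xc matrix_vector_mult_linear_continuous_on
      primitive_continuous L2_integrable continuous_imp_integrable_real u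
      linear_continuous_on_compose[OF _ matrix_vector_mul_linear])
  have "synthesis \<tau> w \<phi> = - (LINT t|ivl_measure \<tau>. ivl_deriv \<tau> \<phi> t *\<^sub>R ?g t)" if \<phi>: "\<phi> \<in> H10 \<tau>" for \<phi>
  proof -
    have "synthesis \<tau> w \<phi> = - (LINT t|ivl_measure \<tau>. ivl_deriv \<tau> \<phi> t *\<^sub>R integral {0..t} w)"
      unfolding synthesis_def by (rule integral_by_parts[OF \<phi> L2_integrable[OF w] \<open>\<tau> > 0\<close>])
    also have "(LINT t|ivl_measure \<tau>. ivl_deriv \<tau> \<phi> t *\<^sub>R integral {0..t} w)
        = (LINT t|ivl_measure \<tau>. ivl_deriv \<tau> \<phi> t *\<^sub>R ?g t - ivl_deriv \<tau> \<phi> t *\<^sub>R x 0)"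
      by (rule Bochner_Integration.integral_cong) (simp_all add: prim scaleR_diff_right)
    also have "\<dots> = (LINT t|ivl_measure \<tau>. ivl_deriv \<tau> \<phi> t *\<^sub>R ?g t) - (LINT t|ivl_measure \<tau>. ivl_deriv \<tau> \<phi> t *\<^sub>R x 0)"
      by (intro Bochner_Integration.integral_diff H10_deriv_integrable[OF \<phi>] g continuous_on_const)
    finally show ?thesis by (simp add: H10_deriv_const[OF \<phi> \<open>\<tau> > 0\<close>])
  qed
  with g show ?thesis by (simp add: represents_def)
qed

text \<open>The pairing with \<open>\<xi>\<close> of the centred function that represents the operator \<open>X\<^sub>d - A X - B U\<close>, with \<open>y\<close> and \<open>z\<close>
in place of \<open>A\<^sup>T \<xi>\<close> and \<open>B\<^sup>T \<xi>\<close>.\<close>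

definition residual ::
  "real \<Rightarrow> (real \<Rightarrow> real^'n) \<Rightarrow> (real \<Rightarrow> real^'m) \<Rightarrow> (real^'n) \<times> (real^'n) \<times> (real^'m) \<Rightarrow> real \<Rightarrow> real" where
  "residual \<tau> x u = (\<lambda>(\<xi>, y, z) t. centred \<tau> x t \<bullet> \<xi> -
     centred \<tau> (\<lambda>s. integral {0..s} x) t \<bullet> y - centred \<tau> (\<lambda>s. integral {0..s} u) t \<bullet> z)"

definition data_form ::
  "real \<Rightarrow> (real \<Rightarrow> real^'n) \<Rightarrow> (real \<Rightarrow> real^'m) \<Rightarrow> (real^'n) \<times> (real^'n) \<times> (real^'m) \<Rightarrow>
   (real^'n) \<times> (real^'n) \<times> (real^'m) \<Rightarrow> real" where
  "data_form \<tau> x u p r = (LINT t|ivl_measure \<tau>. residual \<tau> x u p t * residual \<tau> x u r t)"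

locale trajectory_data =
  fixes \<tau> :: real and x :: "real \<Rightarrow> real^'n" and u :: "real \<Rightarrow> real^'m" and c :: real
  assumes \<tau>: "\<tau> > 0" and x: "x \<in> H1 \<tau>" and u: "u \<in> L2 \<tau>"
begin

abbreviation "\<X> \<equiv> \<lambda>s. integral {0..s} x"
abbreviation "\<U> \<equiv> \<lambda>s. integral {0..s} u"

lemma data_continuous: "continuous_on {0..\<tau>} x" "continuous_on {0..\<tau>} \<X>" "continuous_on {0..\<tau>} \<U>"
  by (intro H1_continuous[OF x] primitive_continuous L2_integrable[OF u] continuous_imp_integrable_real)+

lemma represents_data:
  "represents \<tau> (diff_synthesis \<tau> x) x" "represents \<tau> (synthesis \<tau> x) \<X>" "represents \<tau> (synthesis \<tau> u) \<U>"
  by (intro represents_diff_synthesis represents_synthesis x u \<tau> continuous_L2 data_continuous)+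

lemma residual_continuous: "continuous_on {0..\<tau>} (residual \<tau> x u p)"
  unfolding residual_def split_def by (intro continuous_intros centred_continuous data_continuous)

lemma residual_integrable: "integrable (ivl_measure \<tau>) (\<lambda>t. residual \<tau> x u p t * residual \<tau> x u r t)"
  by (intro continuous_imp_integrable_real continuous_intros residual_continuous)

lemma residual_linear:
  "residual \<tau> x u (p + r) t = residual \<tau> x u p t + residual \<tau> x u r t"
  "residual \<tau> x u (s *\<^sub>R p) t = s * residual \<tau> x u p t"
  by (simp_all add: residual_def split_def inner_add_right algebra_simps)

sublocale qmi "data_form \<tau> x u" c
proof
  show "bilinear (data_form \<tau> x u)"
    unfolding bilinear_def linear_iff
    by (simp add: data_form_def residual_linear distrib_left distrib_right residual_integrable mult.assoc mult.left_commute)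
qed (simp_all add: data_form_def mult.commute)

lemma inner_mult_adj_noise:
  assumes "w \<in> L2 \<tau>" "satisfies_system \<tau> A B x u w"
  shows "\<xi> \<bullet> (mult_adj \<tau> (synthesis \<tau> w) (synthesis \<tau> w) *v \<xi>)
      = data_form \<tau> x u (\<xi>, transpose A *v \<xi>, transpose B *v \<xi>) (\<xi>, transpose A *v \<xi>, transpose B *v \<xi>)"
proof -
  let ?g = "\<lambda>t. x t - A *v \<X> t - B *v \<U> t"
  note rep = represents_noise[OF x u assms \<tau>]
  have "centred \<tau> ?g t \<bullet> \<xi> = residual \<tau> x u (\<xi>, transpose A *v \<xi>, transpose B *v \<xi>) t" for t
  proof -
    have "integral {0..\<tau>} ?g = integral {0..\<tau>} x - A *v integral {0..\<tau>} \<X> - B *v integral {0..\<tau>} \<U>"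
      using data_continuous[THEN integrable_continuous_real]
      by (simp add: Henstock_Kurzweil_Integration.integral_diff integrable_diff integrable_matrix_vector_mult integral_matrix_vector_mult)
    note eq = this
    have "centred \<tau> ?g t = centred \<tau> x t - A *v centred \<tau> \<X> t - B *v centred \<tau> \<U> t"
      unfolding centred_def eq by (simp add: matrix_vector_mult_diff_distrib matrix_vector_mult_scaleR algebra_simps)
    then show ?thesis
      using inner_transpose[of "centred \<tau> \<X> t" A \<xi>] inner_transpose[of "centred \<tau> \<U> t" B \<xi>]
      by (simp add: residual_def inner_diff_left)
  qed
  then show ?thesis
    by (simp add: inner_mult_adj[OF rep rep \<tau>] data_form_def)
qed

lemma transpose_mult_adj:
  assumes "represents \<tau> S f" "represents \<tau> T g"
  shows "transpose (mult_adj \<tau> S T) = mult_adj \<tau> T S"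
proof -
  have "w \<bullet> (transpose (mult_adj \<tau> S T) *v v) = w \<bullet> (mult_adj \<tau> T S *v v)" for v w
    using inner_mult_adj[OF assms(1,2) \<tau>, of v w] inner_mult_adj[OF assms(2,1) \<tau>, of w v]
    by (simp only: inner_transpose) (simp add: inner_commute mult.commute)
  then show ?thesis by (metis matrix_eq vector_eq_ldot)
qed

text \<open>Given \<open>(A, B)\<close>, the noise is forced to be \<open>x' - A x - B u\<close> up to null sets, and the bound on \<open>W W\<^sup>*\<close> says
that \<open>q\<close> is nonnegative along the graph of \<open>\<xi> \<mapsto> (A\<^sup>T \<xi>, B\<^sup>T \<xi>)\<close>.\<close>

lemma consistent_iff:
  "(A, B) \<in> consistent_systems \<tau> c (x, u) \<longleftrightarrow> (\<forall>\<xi>. q \<xi> (transpose A *v \<xi>, transpose B *v \<xi>) \<ge> 0)"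
proof -
  have noise: "w \<in> noise_class \<tau> c \<longleftrightarrow> (\<forall>\<xi>. q \<xi> (transpose A *v \<xi>, transpose B *v \<xi>) \<ge> 0)"
    if w: "w \<in> L2 \<tau>" and sys: "satisfies_system \<tau> A B x u w" for w
  proof -
    note rep = represents_noise[OF x u w sys \<tau>]
    let ?W = "mult_adj \<tau> (synthesis \<tau> w) (synthesis \<tau> w)"
    have "transpose (c *\<^sub>R mat 1 - ?W) = c *\<^sub>R mat 1 - ?W"
    proof -
      have "transpose (c *\<^sub>R mat 1 - M) = c *\<^sub>R mat 1 - transpose M" for M :: "real^'n^'n"
        by (simp add: transpose_def mat_def vec_eq_iff)
      then show ?thesis by (simp add: transpose_mult_adj[OF rep rep])
    qed
    moreover have "\<xi> \<bullet> ((c *\<^sub>R mat 1 - ?W) *v \<xi>) = q \<xi> (transpose A *v \<xi>, transpose B *v \<xi>)" for \<xi>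
      using inner_mult_adj_noise[OF w sys, of \<xi>]
      by (simp add: q_def matrix_vector_mult_diff_rdistrib inner_diff_right scaleR_matrix_vector_assoc[symmetric])
    ultimately show ?thesis using w by (simp add: noise_class_def loewner_le_def pos_semidef_def)
  qed
  have "(A, B) \<in> consistent_systems \<tau> c (x, u)" if "\<forall>\<xi>. q \<xi> (transpose A *v \<xi>, transpose B *v \<xi>) \<ge> 0"
  proof -
    define w where "w t = ivl_deriv \<tau> x t - A *v x t - B *v u t" for t
    have "w \<in> L2 \<tau>"
      unfolding w_def using x u
      by (intro L2_diff L2_matrix_vector_mult continuous_L2[OF data_continuous(1)]) (auto simp: H1_def)
    moreover have sys: "satisfies_system \<tau> A B x u w"
      by (simp add: satisfies_system_def w_def)
    ultimately have "w \<in> noise_class \<tau> c" using noise that by blast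
    then show ?thesis using sys by (auto simp: consistent_systems_def)
  qed
  moreover have "\<forall>\<xi>. q \<xi> (transpose A *v \<xi>, transpose B *v \<xi>) \<ge> 0" if "(A, B) \<in> consistent_systems \<tau> c (x, u)"
    using that noise by (auto simp: consistent_systems_def noise_class_def)
  ultimately show ?thesis by blast
qed

text \<open>The coefficients of \<open>\<alpha>\<close> in the block matrix assemble to \<open>- q\<close>, so the matrix inequality says that \<open>\<alpha>\<close> is a
multiplier in the sense of the S-lemma.\<close>

lemma pos_semidef_lmi_iff:
  assumes P: "transpose P = P"
  shows "pos_semidef (stab_lmi_matrix \<tau> c (diff_synthesis \<tau> x) (synthesis \<tau> x) (synthesis \<tau> u) P L \<alpha>) \<longleftrightarrow>
    (\<forall>\<xi> y z. - 2 * ((P *v \<xi>, L *v \<xi>) \<bullet> (y, z)) - \<xi> \<bullet> \<xi> \<ge> \<alpha> * q \<xi> (y, z))"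
proof -
  let ?M = "stab_lmi_matrix \<tau> c (diff_synthesis \<tau> x) (synthesis \<tau> x) (synthesis \<tau> u) P L \<alpha>"
  note rep = represents_data
  have tr: "transpose (r *\<^sub>R M) = r *\<^sub>R transpose M" "transpose (M - N) = transpose M - transpose N"
    "transpose (- M) = - transpose M" for M N :: "real^'a^'b" and r
    by (simp_all add: transpose_def vec_eq_iff)
  have "transpose ?M = ?M"
    unfolding stab_lmi_matrix_def transpose_block3
    by (simp add: tr transpose_mult_adj[OF rep(1) rep(1)] transpose_mult_adj[OF rep(1) rep(2)]
        transpose_mult_adj[OF rep(1) rep(3)] transpose_mult_adj[OF rep(2) rep(1)]
        transpose_mult_adj[OF rep(2) rep(2)] transpose_mult_adj[OF rep(2) rep(3)]
        transpose_mult_adj[OF rep(3) rep(1)] transpose_mult_adj[OF rep(3) rep(2)]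
        transpose_mult_adj[OF rep(3) rep(3)] P)
  moreover have "join3 \<xi> y z \<bullet> (?M *v join3 \<xi> y z) =
      - 2 * ((P *v \<xi>, L *v \<xi>) \<bullet> (y, z)) - \<xi> \<bullet> \<xi> - \<alpha> * q \<xi> (y, z)" for \<xi> y z
  proof -
    let ?C = "\<lambda>t. centred \<tau> x t \<bullet> \<xi>" and ?Y = "\<lambda>t. centred \<tau> \<X> t \<bullet> y" and ?Z = "\<lambda>t. centred \<tau> \<U> t \<bullet> z"
    let ?I = "\<lambda>f. LINT t|ivl_measure \<tau>. f t"
    have c: "continuous_on {0..\<tau>} ?C" "continuous_on {0..\<tau>} ?Y" "continuous_on {0..\<tau>} ?Z"
      by (intro continuous_intros centred_continuous data_continuous)+
    have i: "integrable (ivl_measure \<tau>) (\<lambda>t. f t * g t)"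
      if "continuous_on {0..\<tau>} f" "continuous_on {0..\<tau>} g" for f g :: "real \<Rightarrow> real"
      by (intro continuous_imp_integrable_real continuous_intros that)
    have "data_form \<tau> x u (\<xi>, y, z) (\<xi>, y, z) =
        ?I (\<lambda>t. ?C t * ?C t - ?C t * ?Y t - ?C t * ?Z t - ?Y t * ?C t + ?Y t * ?Y t + ?Y t * ?Z t
        - ?Z t * ?C t + ?Z t * ?Y t + ?Z t * ?Z t)"
      unfolding data_form_def
      by (rule Bochner_Integration.integral_cong) (simp_all add: residual_def algebra_simps)
    also have "\<dots> =
        ?I (\<lambda>t. ?C t * ?C t) - ?I (\<lambda>t. ?C t * ?Y t) - ?I (\<lambda>t. ?C t * ?Z t) - ?I (\<lambda>t. ?Y t * ?C t)
        + ?I (\<lambda>t. ?Y t * ?Y t) + ?I (\<lambda>t. ?Y t * ?Z t) - ?I (\<lambda>t. ?Z t * ?C t)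
        + ?I (\<lambda>t. ?Z t * ?Y t) + ?I (\<lambda>t. ?Z t * ?Z t)"
      using i c by (simp add: mult.commute)
    finally have form: "data_form \<tau> x u (\<xi>, y, z) (\<xi>, y, z) =
        ?I (\<lambda>t. ?C t * ?C t) - ?I (\<lambda>t. ?C t * ?Y t) - ?I (\<lambda>t. ?C t * ?Z t) - ?I (\<lambda>t. ?Y t * ?C t)
        + ?I (\<lambda>t. ?Y t * ?Y t) + ?I (\<lambda>t. ?Y t * ?Z t) - ?I (\<lambda>t. ?Z t * ?C t)
        + ?I (\<lambda>t. ?Z t * ?Y t) + ?I (\<lambda>t. ?Z t * ?Z t)" .
    have PL: "\<xi> \<bullet> (P *v y) = (P *v \<xi>) \<bullet> y" "\<xi> \<bullet> (transpose L *v z) = (L *v \<xi>) \<bullet> z"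
      "y \<bullet> (P *v \<xi>) = (P *v \<xi>) \<bullet> y" "z \<bullet> (L *v \<xi>) = (L *v \<xi>) \<bullet> z"
      using inner_transpose[of \<xi> P y] inner_transpose[of \<xi> L z] unfolding P by (simp_all only: inner_commute)
    note G = inner_mult_adj[OF rep(1) rep(1) \<tau>] inner_mult_adj[OF rep(1) rep(2) \<tau>] inner_mult_adj[OF rep(1) rep(3) \<tau>]
      inner_mult_adj[OF rep(2) rep(1) \<tau>] inner_mult_adj[OF rep(2) rep(2) \<tau>] inner_mult_adj[OF rep(2) rep(3) \<tau>]
      inner_mult_adj[OF rep(3) rep(1) \<tau>] inner_mult_adj[OF rep(3) rep(2) \<tau>] inner_mult_adj[OF rep(3) rep(3) \<tau>]
    show ?thesis
      unfolding stab_lmi_matrix_def block3_quadratic_form q_def form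
      by (simp add: matrix_vector_mult_diff_rdistrib uminus_matrix_vector_mult scaleR_matrix_vector_assoc[symmetric]
          inner_diff_right PL G algebra_simps del: transpose_matrix_vector)
  qed
  ultimately show ?thesis
    unfolding pos_semidef_def by (metis join3_exhaust diff_ge_0_iff_ge)
qed

lemma invertible_matrix_inv_left:
  fixes P :: "real^'n^'n"
  assumes "invertible P"
  shows "matrix_inv P ** P = mat 1"
  using someI_ex[OF assms[unfolded invertible_def]] by (simp add: matrix_inv_def)

lemma inner_closed_loop:
  "(P *v \<xi>, (K ** P) *v \<xi>) \<bullet> (transpose A *v \<xi>, transpose B *v \<xi>) = \<xi> \<bullet> ((A + B ** K) *v (P *v \<xi>))"
  for A P :: "real^'n^'n" and B :: "real^'m^'n"
proof -
  have "(A + B ** K) *v (P *v \<xi>) = A *v (P *v \<xi>) + B *v ((K ** P) *v \<xi>)"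
    by (simp add: matrix_vector_mult_add_rdistrib flip: matrix_vector_mul_assoc)
  then show ?thesis
    by (simp only: inner_Pair inner_transpose inner_add_right inner_commute[of _ "transpose _ *v _"])
      (simp add: inner_commute)
qed

lemma feasible_consistent:
  assumes "feasible Z"
  obtains A B where "(A, B) \<in> consistent_systems \<tau> c (x, u)"
    "\<And>\<xi>. Z \<xi> = (transpose A *v \<xi>, transpose B *v \<xi>)"
proof -
  have Z: "linear Z" "\<And>\<xi>. q \<xi> (Z \<xi>) \<ge> 0" using assms by (auto simp: feasible_def)
  define A where "A = transpose (matrix (\<lambda>\<xi>. fst (Z \<xi>)))"
  define B where "B = transpose (matrix (\<lambda>\<xi>. snd (Z \<xi>)))"
  have "linear (\<lambda>\<xi>. fst (Z \<xi>))" "linear (\<lambda>\<xi>. snd (Z \<xi>))"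
    using linear_compose[OF Z(1) linear_fst] linear_compose[OF Z(1) linear_snd] by (simp_all add: o_def)
  then have ZAB: "Z \<xi> = (transpose A *v \<xi>, transpose B *v \<xi>)" for \<xi>
    by (simp add: A_def B_def matrix_works linear_matrix_vector_mul_eq del: transpose_matrix_vector)
  then have "(A, B) \<in> consistent_systems \<tau> c (x, u)"
    unfolding consistent_iff using Z(2) by (simp only: ZAB) metis
  with ZAB show ?thesis using that by blast
qed

text \<open>The matrix S-lemma for \<open>R \<xi> = (P \<xi>, K P \<xi>)\<close> produces the block inequality with \<open>\<epsilon> I\<close> in place of the identity;
dividing \<open>P\<close>, \<open>L = K P\<close> and \<open>\<alpha>\<close> by \<open>\<epsilon>\<close> normalises it.\<close>

lemma informative_imp_lmi:
  assumes info: "informative_quad_stab \<tau> c (x, u)"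
    and cons: "(As, Bs) \<in> consistent_systems \<tau> c (x, u)"
  shows "\<exists>P L \<alpha>. \<alpha> \<ge> 0 \<and> pos_def P \<and>
    pos_semidef (stab_lmi_matrix \<tau> c (diff_synthesis \<tau> x) (synthesis \<tau> x) (synthesis \<tau> u) P L \<alpha>)"
proof -
  obtain P K where P: "pos_def P" and
    PK: "\<And>A B. (A, B) \<in> consistent_systems \<tau> c (x, u) \<Longrightarrow>
      pos_def (- ((A + B ** K) ** P) - P ** transpose (A + B ** K))"
    using info unfolding informative_quad_stab_def by fastforce
  have Pt: "transpose P = P" using P by (simp add: pos_def_def)
  define R where "R \<xi> = (P *v \<xi>, (K ** P) *v \<xi>)" for \<xi>
  have R: "linear R"
    by (rule linearI) (simp_all add: R_def matrix_vector_right_distrib matrix_vector_mult_scaleR)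
  define Zs where "Zs \<xi> = (transpose As *v \<xi>, transpose Bs *v \<xi>)" for \<xi>
  have "linear Zs"
    unfolding Zs_def
    by (rule linearI) (simp_all add: matrix_vector_right_distrib matrix_vector_mult_scaleR del: transpose_matrix_vector)
  then have "feasible Zs" using cons by (simp add: feasible_def consistent_iff Zs_def)
  moreover have "R \<xi> \<bullet> Z \<xi> < 0" if Z: "feasible Z" and "\<xi> \<noteq> 0" for Z \<xi>
  proof -
    obtain A B where AB: "(A, B) \<in> consistent_systems \<tau> c (x, u)"
      and ZAB: "\<And>\<xi>. Z \<xi> = (transpose A *v \<xi>, transpose B *v \<xi>)"
      using feasible_consistent[OF Z] by blast
    have "\<xi> \<bullet> ((A + B ** K) *v (P *v \<xi>)) < 0"
      using PK[OF AB] \<open>\<xi> \<noteq> 0\<close> unfolding pos_def_lyapunov_iff[OF Pt] by blast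
    then show ?thesis unfolding R_def ZAB inner_closed_loop .
  qed
  ultimately obtain \<epsilon> \<alpha> where "\<epsilon> > 0" "\<alpha> \<ge> 0"
    and main: "\<And>\<xi> y. - 2 * (R \<xi> \<bullet> y) - \<epsilon> * (\<xi> \<bullet> \<xi>) \<ge> \<alpha> * q \<xi> y"
    using matrix_S_lemma[OF _ _ R] by blast
  let ?P = "(1 / \<epsilon>) *\<^sub>R P" and ?L = "(1 / \<epsilon>) *\<^sub>R (K ** P)"
  have tP: "transpose ?P = ?P" by (simp add: transpose_scalar Pt)
  have "pos_def ?P"
    using P \<open>\<epsilon> > 0\<close> tP by (simp add: pos_def_def scaleR_matrix_vector_assoc[symmetric])
  moreover have "pos_semidef (stab_lmi_matrix \<tau> c (diff_synthesis \<tau> x) (synthesis \<tau> x) (synthesis \<tau> u) ?P ?L (\<alpha> / \<epsilon>))"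
    unfolding pos_semidef_lmi_iff[OF tP]
  proof (intro allI)
    fix \<xi> y z
    have "(1 / \<epsilon>) * (\<alpha> * q \<xi> (y, z)) \<le> (1 / \<epsilon>) * (- 2 * (R \<xi> \<bullet> (y, z)) - \<epsilon> * (\<xi> \<bullet> \<xi>))"
      using main[of \<xi> "(y, z)"] \<open>\<epsilon> > 0\<close> by (intro mult_left_mono) auto
    also have "\<dots> = - 2 * ((1 / \<epsilon>) * (R \<xi> \<bullet> (y, z))) - \<xi> \<bullet> \<xi>"
      using \<open>\<epsilon> > 0\<close> by (simp add: field_simps)
    also have "(1 / \<epsilon>) * (R \<xi> \<bullet> (y, z)) = (?P *v \<xi>, ?L *v \<xi>) \<bullet> (y, z)"
      by (simp add: R_def scaleR_matrix_vector_assoc[symmetric] distrib_left)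
    finally show "\<alpha> / \<epsilon> * q \<xi> (y, z) \<le> - 2 * ((?P *v \<xi>, ?L *v \<xi>) \<bullet> (y, z)) - \<xi> \<bullet> \<xi>"
      by simp
  qed
  moreover have "\<alpha> / \<epsilon> \<ge> 0" using \<open>\<alpha> \<ge> 0\<close> \<open>\<epsilon> > 0\<close> by simp
  ultimately show ?thesis by blast
qed

text \<open>Evaluate the block inequality at \<open>(\<xi>, A\<^sup>T \<xi>, B\<^sup>T \<xi>)\<close>, where the score is nonnegative for consistent systems.\<close>

lemma lmi_imp_lyapunov:
  assumes P: "pos_def P" and "\<alpha> \<ge> 0"
    and lmi: "pos_semidef (stab_lmi_matrix \<tau> c (diff_synthesis \<tau> x) (synthesis \<tau> x) (synthesis \<tau> u) P L \<alpha>)"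
    and AB: "(A, B) \<in> consistent_systems \<tau> c (x, u)" and "\<xi> \<noteq> 0"
  shows "\<xi> \<bullet> ((A + B ** (L ** matrix_inv P)) *v (P *v \<xi>)) < 0"
proof -
  have "transpose P = P" using P by (simp add: pos_def_def)
  note lmi = lmi[unfolded pos_semidef_lmi_iff[OF this]]
  have "(L ** matrix_inv P) ** P = L"
    using invertible_matrix_inv_left[OF pos_def_invertible[OF P]]
    by (simp flip: matrix_mul_assoc)
  then have "\<xi> \<bullet> ((A + B ** (L ** matrix_inv P)) *v (P *v \<xi>))
      = (P *v \<xi>, L *v \<xi>) \<bullet> (transpose A *v \<xi>, transpose B *v \<xi>)"
    using inner_closed_loop[of P \<xi> "L ** matrix_inv P" A B] by (simp only:)
  moreover have "0 \<le> \<alpha> * q \<xi> (transpose A *v \<xi>, transpose B *v \<xi>)"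
    using AB \<open>\<alpha> \<ge> 0\<close> unfolding consistent_iff by (intro mult_nonneg_nonneg) blast+
  moreover have "\<xi> \<bullet> \<xi> > 0" using \<open>\<xi> \<noteq> 0\<close> by simp
  moreover have "\<alpha> * q \<xi> (transpose A *v \<xi>, transpose B *v \<xi>)
      \<le> - 2 * ((P *v \<xi>, L *v \<xi>) \<bullet> (transpose A *v \<xi>, transpose B *v \<xi>)) - \<xi> \<bullet> \<xi>"
    using lmi by blast
  ultimately show ?thesis by linarith
qed

end


section \<open>The equivalence and the stabilizing gain\<close>

theorem theorem5p3:
  fixes \<tau> c :: real
    and x :: "real \<Rightarrow> real^'n" and u :: "real \<Rightarrow> real^'m"
    and As :: "real^'n^'n" and Bs :: "real^'m^'n" and ws :: "real \<Rightarrow> real^'n"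
    and Xd X :: "(real \<Rightarrow> real) \<Rightarrow> real^'n" and U :: "(real \<Rightarrow> real) \<Rightarrow> real^'m"
  assumes "\<tau> > 0" and "c \<ge> 0"
    and "(x, u) \<in> data_space \<tau>"
    and "ws \<in> noise_class \<tau> c"
    and "satisfies_system \<tau> As Bs x u ws"
    and "Xd = diff_synthesis \<tau> x" and "X = synthesis \<tau> x" and "U = synthesis \<tau> u"
  shows "(informative_quad_stab \<tau> c (x, u) \<longleftrightarrow>
           (\<exists>(P::real^'n^'n) (L::real^'n^'m) \<alpha>. \<alpha> \<ge> 0 \<and> pos_def P \<and>
              pos_semidef (stab_lmi_matrix \<tau> c Xd X U P L \<alpha>))) \<and>
         (\<forall>(P::real^'n^'n) (L::real^'n^'m) \<alpha>.
            \<alpha> \<ge> 0 \<and> pos_def P \<and> pos_semidef (stab_lmi_matrix \<tau> c Xd X U P L \<alpha>) \<longrightarrow>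
            (\<forall>(A, B) \<in> consistent_systems \<tau> c (x, u). hurwitz (A + B ** (L ** matrix_inv P))))"
proof -
  interpret trajectory_data \<tau> x u c
    using assms by unfold_locales (auto simp: data_space_def)
  note ops = \<open>Xd = diff_synthesis \<tau> x\<close> \<open>X = synthesis \<tau> x\<close> \<open>U = synthesis \<tau> u\<close>
  have cons: "(As, Bs) \<in> consistent_systems \<tau> c (x, u)"
    using assms(4,5) by (auto simp: consistent_systems_def)
  show ?thesis
  proof (intro conjI iffI allI impI)
    assume "informative_quad_stab \<tau> c (x, u)"
    then show "\<exists>(P::real^'n^'n) (L::real^'n^'m) \<alpha>. \<alpha> \<ge> 0 \<and> pos_def P \<and>
              pos_semidef (stab_lmi_matrix \<tau> c Xd X U P L \<alpha>)"
      unfolding ops by (rule informative_imp_lmi[OF _ cons])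
  next
    assume "\<exists>(P::real^'n^'n) (L::real^'n^'m) \<alpha>. \<alpha> \<ge> 0 \<and> pos_def P \<and>
              pos_semidef (stab_lmi_matrix \<tau> c Xd X U P L \<alpha>)"
    then obtain P :: "real^'n^'n" and L :: "real^'n^'m" and \<alpha> where PL: "pos_def P" "\<alpha> \<ge> 0"
      "pos_semidef (stab_lmi_matrix \<tau> c (diff_synthesis \<tau> x) (synthesis \<tau> x) (synthesis \<tau> u) P L \<alpha>)"
      unfolding ops by blast
    have "transpose P = P" using PL(1) by (simp add: pos_def_def)
    note iff = pos_def_lyapunov_iff[OF this]
    show "informative_quad_stab \<tau> c (x, u)"
      unfolding informative_quad_stab_def
      using PL(1) lmi_imp_lyapunov[OF PL] by (intro exI[of _ P] exI[of _ "L ** matrix_inv P"]) (auto simp: iff)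
  next
    fix P :: "real^'n^'n" and L :: "real^'n^'m" and \<alpha>
    assume "\<alpha> \<ge> 0 \<and> pos_def P \<and> pos_semidef (stab_lmi_matrix \<tau> c Xd X U P L \<alpha>)"
    then have PL: "pos_def P" "\<alpha> \<ge> 0"
      "pos_semidef (stab_lmi_matrix \<tau> c (diff_synthesis \<tau> x) (synthesis \<tau> x) (synthesis \<tau> u) P L \<alpha>)"
      unfolding ops by blast+
    show "\<forall>(A, B) \<in> consistent_systems \<tau> c (x, u). hurwitz (A + B ** (L ** matrix_inv P))"
      using lyapunov_hurwitz[OF PL(1)] lmi_imp_lyapunov[OF PL] by blast
  qed
qed

end
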